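(* For every fixed $\epsilon>0$ there exists $d_0=d_0(\epsilon)$ such that for every fixed integer $d\ge d_0$, asymptotically almost surely a graph $G\in\mathcal{G}_{n,d}$ satisfies \[ n\left(1-(1+\epsilon)\frac{4\log d}{d}\right)\le Z(G)\le n\left(1-(1-\epsilon)\frac{\log d}{2d}\right). \]
   Context: $\mathcal{G}_{n,d}$ denotes the uniform probability space of (simple) $d$-regular graphs on $n$ labelled vertices, with $d$ fixed, $n\to\infty$, and $n$ even if $d$ is odd. An event holds asymptotically almost surely (a.a.s.) if its probability tends to $1$ as $n\to\infty$. $\log$ is the natural logarithm. Zero forcing: given a graph $G$ and an initial set $S$ of vertices coloured black (all others white), repeatedly, a black vertex with exactly one white neighbour forces that neighbour to become black; $S$ is a zero forcing set if eventually all vertices are black. $Z(G)$, the zero forcing number, is the minimum size of a zero forcing set of $G$. *)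

theory Defs
  imports Complex_Main
begin

text \<open>Simple graphs on the labelled vertex set {0..<n}: a set of 2-element edges.\<close>

definition all_pairs :: "nat \<Rightarrow> nat set set" where
  "all_pairs n = {{u, v} | u v. u < n \<and> v < n \<and> u \<noteq> v}"

definition regular_graphs :: "nat \<Rightarrow> nat \<Rightarrow> nat set set set" where
  "regular_graphs n d =
     {E. E \<subseteq> all_pairs n \<and> (\<forall>v<n. card {u. {v, u} \<in> E} = d)}"

definition prob_reg :: "nat \<Rightarrow> nat \<Rightarrow> (nat set set \<Rightarrow> bool) \<Rightarrow> real" where
  "prob_reg n d P = real (card {E \<in> regular_graphs n d. P E}) / real (card (regular_graphs n d))"

definition aas :: "nat \<Rightarrow> (nat \<Rightarrow> nat set set \<Rightarrow> bool) \<Rightarrow> bool" where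
  "aas d P \<longleftrightarrow>
     ((\<lambda>n. prob_reg n d (P n)) \<longlongrightarrow> 1) (inf sequentially (principal {n. even (n * d)}))"

definition force_step :: "nat \<Rightarrow> nat set set \<Rightarrow> nat set \<Rightarrow> nat set \<Rightarrow> bool" where
  "force_step n E B B' \<longleftrightarrow>
     (\<exists>v w. v \<in> B \<and> w < n \<and> w \<notin> B \<and> {v, w} \<in> E \<and>
        (\<forall>u. {v, u} \<in> E \<and> u \<notin> B \<longrightarrow> u = w) \<and> B' = insert w B)"

definition zero_forcing_set :: "nat \<Rightarrow> nat set set \<Rightarrow> nat set \<Rightarrow> bool" where
  "zero_forcing_set n E S \<longleftrightarrow> S \<subseteq> {0..<n} \<and> (force_step n E)\<^sup>*\<^sup>* S {0..<n}"

definition zero_forcing_number :: "nat \<Rightarrow> nat set set \<Rightarrow> nat" where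
  "zero_forcing_number n E = (LEAST k. \<exists>S. zero_forcing_set n E S \<and> card S = k)"

end

theory Submission
  imports Defs "HOL-Real_Asymp.Real_Asymp"
begin

text \<open>Lower bound: if \<open>v\<^sub>i\<close> forces \<open>w\<^sub>i\<close> at step \<open>i\<close>, then \<open>v\<^sub>i\<close> is not adjacent to \<open>w\<^sub>j\<close> for \<open>j > i\<close>. So \<open>2 s\<close> forcing
  steps yield disjoint sets \<open>A = {v\<^sub>1, \<dots>, v\<^sub>s}\<close> and \<open>B = {w\<^sub>s\<^sub>+\<^sub>1, \<dots>, w\<^sub>2\<^sub>s}\<close> without an edge between them. Switchings,
  applied directly to simple regular graphs, show that for fixed \<open>A\<close> and \<open>B\<close> this has probability roughly
  \<open>exp (- d s\<^sup>2 / n)\<close>, which beats the number \<open>(e n / s)\<^sup>2\<^sup>s\<close> of pairs \<open>(A, B)\<close> as soon as \<open>s\<close> exceeds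
  \<open>2 (1 + \<epsilon>) n ln d / d\<close>.

  Upper bound: by switchings again, the expected number of vertices on triangles and 4-cycles is bounded in
  \<open>n\<close>. Put every vertex into \<open>W\<close> independently with probability \<open>p = ln d / (2 d)\<close>. The neighbours of a
  vertex \<open>w \<in> W\<close> on no short cycle have disjoint neighbourhoods apart from \<open>w\<close>, so with probability close to
  1 one of them lies outside \<open>W\<close> and has \<open>w\<close> as its only neighbour in \<open>W\<close>. Colouring all vertices black
  except those \<open>w \<in> W\<close> that have such a private neighbour gives a zero forcing set.\<close>

section \<open>Elementary estimates\<close>

text \<open>One half of Stirling's formula. Passing from \<open>k\<close> to \<open>k + 1\<close>
  amounts to \<open>(1 - 1 / (k + 2)) ^ (k + 2) \<le> exp (- 1)\<close>. It later converts a
  telescoped quotient \<open>fact J / x ^ J\<close> with \<open>J\<close> close to \<open>x\<close>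
  into \<open>exp (- x)\<close>, up to a factor linear in \<open>x\<close>.\<close>

lemma fact_exp_le: "fact k * exp (real k) \<le> (real k + 1) ^ (k + 1)"
proof (induction k)
  case (Suc k)
  let ?m = "real k + 1"
  have "?m / (?m + 1) = 1 + - (1 / (?m + 1))" by (simp add: field_simps)
  also have "\<dots> \<le> exp (- (1 / (?m + 1)))" by (rule exp_ge_add_one_self)
  finally have "(?m / (?m + 1)) ^ (k + 2) \<le> exp (- (1 / (?m + 1))) ^ (k + 2)"
    by (intro power_mono) auto
  also have "\<dots> = exp (real (k + 2) * - (1 / (?m + 1)))" by (rule exp_of_nat_mult[symmetric])
  also have "real (k + 2) * - (1 / (?m + 1)) = - 1" by (simp add: field_simps)
  finally have "?m ^ (k + 2) / (?m + 1) ^ (k + 2) \<le> exp (- 1)" by (simp only: power_divide)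
  moreover have "0 < (?m + 1) ^ (k + 2)" by (intro zero_less_power) simp
  ultimately have m: "?m ^ (k + 2) \<le> (?m + 1) ^ (k + 2) * exp (- 1)"
    by (simp only: pos_divide_le_eq mult.commute)
  have "fact (Suc k) * exp (real (Suc k)) = ?m * exp 1 * (fact k * exp (real k))"
    by (simp add: exp_add algebra_simps)
  also have "\<dots> \<le> ?m * exp 1 * ?m ^ (k + 1)"
    by (intro mult_left_mono Suc.IH) auto
  also have "\<dots> = exp 1 * ?m ^ (k + 2)" by simp
  also have "\<dots> \<le> exp 1 * ((?m + 1) ^ (k + 2) * exp (- 1))"
    by (intro mult_left_mono m) auto
  also have "\<dots> = (?m + 1) ^ (k + 2)" by (simp add: exp_minus)
  finally show ?case by (simp add: add.commute)
qed simp

text \<open>The other half of Stirling's formula, by \<open>(1 + 1 / k) ^ k \<le> exp 1\<close>; it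
  bounds the number of candidate sets in the union bound.\<close>

lemma power_le_fact_exp: "real k ^ k \<le> fact k * exp (real k)"
proof (induction k)
  case (Suc k)
  show ?case
  proof (cases "k = 0")
    case False
    have "(1 + 1 / real k) ^ k \<le> exp 1"
      using exp_ge_one_plus_x_over_n_power_n[of k 1] False by simp
    then have "(real k + 1) ^ k \<le> exp 1 * real k ^ k"
      using False by (simp add: field_simps power_divide)
    also have "\<dots> \<le> exp 1 * (fact k * exp (real k))"
      by (intro mult_left_mono Suc.IH) auto
    finally have "(real k + 1) * (real k + 1) ^ k \<le> (real k + 1) * (exp 1 * (fact k * exp (real k)))"
      by (intro mult_left_mono) auto
    then show ?thesis by (simp add: exp_add algebra_simps)
  qed simp
qed simp

lemma binomial_le_exp_power:
  assumes "s > 0"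
  shows "real (n choose s) \<le> (exp 1 * n / s) ^ s"
proof -
  have "real ((n choose s) * fact s) \<le> real (n ^ s)"
    by (simp only: of_nat_le_iff binomial_fact_pow)
  then have "real (n choose s) * fact s \<le> real n ^ s" by simp
  then have "real (n choose s) * fact s * real s ^ s \<le> real n ^ s * (fact s * exp (real s))"
    by (intro mult_mono power_le_fact_exp) auto
  then have "real (n choose s) * real s ^ s \<le> real n ^ s * exp (real s)"
    by (simp add: mult_ac)
  moreover have "exp (real s) = exp 1 ^ s" by (simp add: exp_of_nat_mult[symmetric])
  ultimately show ?thesis using assms by (simp add: field_simps power_divide power_mult_distrib)
qed

section \<open>Limits and eventual inequalities\<close>

lemma linear_times_exp_decay:
  fixes a b :: real
  assumes "0 < a" "0 < b"
  shows "(\<lambda>n::nat. b * n * exp 2 * exp (- a * n)) \<longlonglongrightarrow> 0"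
  using assms by real_asymp

lemma const_over_linear_tendsto_0:
  fixes a c :: real
  assumes "0 < a"
  shows "(\<lambda>n::nat. c / (a * n)) \<longlonglongrightarrow> 0"
  using assms by real_asymp

lemma eventually_linear_ge_1:
  fixes a :: real
  assumes "0 < a"
  shows "\<forall>\<^sub>F n::nat in sequentially. 1 \<le> a * n"
  using assms by real_asymp

lemma eventually_const_over_less:
  fixes c \<delta> :: real
  assumes "0 < \<delta>"
  shows "\<forall>\<^sub>F n::nat in sequentially. c / n < \<delta>"
  using assms by real_asymp

lemma eventually_ln_over_less:
  fixes c \<delta> :: real
  assumes "0 < \<delta>"
  shows "\<forall>\<^sub>F n::nat in sequentially. c * (ln n / n) < \<delta>"
  using assms by real_asymp

lemma eventually_ge_ln: "\<forall>\<^sub>F n::nat in sequentially. c \<le> ln n"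
  by real_asymp

text \<open>With \<open>p = ln n / (2 n)\<close> the expression \<open>n (1 - p)\<^sup>n\<close> grows like \<open>sqrt n\<close>.\<close>

lemma eventually_exp_neg_power_less:
  fixes \<delta> :: real
  assumes "0 < \<delta>"
  shows "\<forall>\<^sub>F n::nat in sequentially. exp (- (n * (1 - ln n / (2 * n)) powr n)) < \<delta>"
  using assms by real_asymp

text \<open>The right-hand product is a lower bound for the number of switchings available in a
  graph with \<open>j\<close> crossing edges. Its two factors lose relative errors \<open>a\<close>
  and \<open>b\<close> against \<open>(s * d)\<^sup>2\<close> and \<open>n * d\<close>, and
  \<open>a + b\<close> is exactly the quantity bounded by \<eta>.\<close>

lemma switching_ratio_bound:
  fixes n d s j \<eta> :: real
  assumes "n > 0" "d \<ge> 0" "s \<ge> 0" "j \<ge> 0" and j: "j \<le> d * s\<^sup>2 / n"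
    and \<eta>: "6 * (s / n) + (3 * d + 4) / n \<le> \<eta>" "\<eta> \<le> 1"
  shows "(1 - \<eta>) * ((s * d)\<^sup>2 * (n * d))
    \<le> ((s * d - j)\<^sup>2 - j * d\<^sup>2) * (n * d - 4 * s * d - 2 * (d + 2) * d)"
    and "0 \<le> n * d - 4 * s * d - 2 * (d + 2) * d"
proof -
  define a b where "a = 2 * (s / n) + d / n" and "b = 4 * (s / n) + 2 * (d + 2) / n"
  have ab: "0 \<le> a" "0 \<le> b" "a + b \<le> \<eta>"
    using assms by (auto simp: a_def b_def add_divide_distrib)
  have b: "n * d - 4 * s * d - 2 * (d + 2) * d = n * d * (1 - b)"
    using assms by (simp add: b_def field_simps)
  then show "0 \<le> n * d - 4 * s * d - 2 * (d + 2) * d" using ab \<eta> assms by simp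
  \<comment> \<open>The expression on the right decreases in \<open>j\<close>, so the largest
    admissible value \<open>d * s\<^sup>2 / n\<close> determines \<open>a\<close>.\<close>
  have "(s * d)\<^sup>2 * (1 - a) = (s * d)\<^sup>2 - 2 * (s * d) * (d * s\<^sup>2 / n) - (d * s\<^sup>2 / n) * d\<^sup>2"
    using assms by (simp add: a_def field_simps power2_eq_square)
  also have "\<dots> \<le> (s * d)\<^sup>2 - 2 * (s * d) * j - j * d\<^sup>2"
    using j assms by (intro diff_mono mult_left_mono mult_right_mono) auto
  also have "\<dots> \<le> (s * d - j)\<^sup>2 - j * d\<^sup>2" by (simp add: power2_diff)
  finally have a: "(s * d)\<^sup>2 * (1 - a) \<le> (s * d - j)\<^sup>2 - j * d\<^sup>2" .
  have "1 - \<eta> \<le> 1 - a - b" using ab by simp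
  also have "\<dots> \<le> (1 - a) * (1 - b)" using ab by (simp add: algebra_simps)
  finally have "(1 - \<eta>) * ((s * d)\<^sup>2 * (n * d)) \<le> (1 - a) * (1 - b) * ((s * d)\<^sup>2 * (n * d))"
    using assms by (intro mult_right_mono) auto
  also have "\<dots> = ((s * d)\<^sup>2 * (1 - a)) * (n * d * (1 - b))" by simp
  also have "\<dots> \<le> ((s * d - j)\<^sup>2 - j * d\<^sup>2) * (n * d * (1 - b))"
    using a ab \<eta> assms by (intro mult_right_mono) auto
  finally show "(1 - \<eta>) * ((s * d)\<^sup>2 * (n * d))
    \<le> ((s * d - j)\<^sup>2 - j * d\<^sup>2) * (n * d - 4 * s * d - 2 * (d + 2) * d)"
    using b by simp
qed

text \<open>Entropy against probability. As \<open>s\<close> is at least \<tau> \<open>* n\<close>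
  and \<open>exp 1 \<le> d *\<close> \<tau>, the base \<open>exp 1 * n / s\<close> is at most
  \<open>d\<close>, so the pairs cost at most \<open>exp (2 * s * ln d)\<close>. On the other side
  \<open>x\<close> is at least \<open>2 * s * ln d\<close> times \<open>(1 -\<close>
  \<eta>\<open>) * (1 +\<close> \<epsilon> \<open>/ 2)\<close>, which leaves a surplus of
  \<open>c * s\<close> in the exponent.\<close>

lemma empty_pair_union_bound:
  fixes n d s \<eta> \<tau> \<epsilon> :: real and k :: nat
  assumes "n > 0" "d > 0" "s > 0" "s \<le> n" "0 \<le> \<eta>" "\<eta> < 1" "s = real k"
    and \<tau>: "\<tau> = 2 * (1 + \<epsilon> / 2) * ln d / d" "exp 1 \<le> d * \<tau>" "\<tau> * n \<le> s"
    and c: "c = 2 * ln d * ((1 - \<eta>) * (1 + \<epsilon> / 2) - 1)" "0 \<le> c"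
    and x: "x = (1 - \<eta>) * (d * s\<^sup>2 / n)" "1 \<le> x"
  shows "(exp 1 * n / s) ^ (2 * k) * (x * exp (2 - x)) \<le> d * n * exp 2 * exp (- (c * \<tau>) * n)"
proof -
  have "0 < d * \<tau>" using \<tau>(2) exp_gt_zero[of "1::real"] by linarith
  then have tpos: "0 < \<tau>" using \<open>d > 0\<close> by (simp add: zero_less_mult_iff)
  have "exp 1 * n \<le> d * \<tau> * n" using \<tau>(2) assms(1) by (intro mult_right_mono) auto
  also have "\<dots> \<le> d * s" using \<tau>(3) assms(2) by simp
  finally have "exp 1 * n / s \<le> d" using \<open>s > 0\<close> by (simp add: field_simps)
  then have "(exp 1 * n / s) ^ (2 * k) \<le> d ^ (2 * k)" using assms by (intro power_mono) auto
  also have "d ^ (2 * k) = exp (2 * s * ln d)"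
    using exp_of_nat_mult[of "2 * k" "ln d"] assms by simp
  finally have 1: "(exp 1 * n / s) ^ (2 * k) \<le> exp (2 * s * ln d)" .
  have "s\<^sup>2 / n \<le> n * n / n" unfolding power2_eq_square using assms by (intro divide_right_mono mult_mono) auto
  then have "d * s\<^sup>2 / n \<le> d * n" using assms by (simp add: field_simps)
  moreover have "x \<le> 1 * (d * s\<^sup>2 / n)" unfolding x(1) using assms by (intro mult_right_mono) auto
  ultimately have 2: "x \<le> d * n" by simp
  have "(1 - \<eta>) * (1 + \<epsilon> / 2) * (2 * ln d) * s = (1 - \<eta>) * (d * (\<tau> * s))"
    using assms by (simp add: \<tau>(1))
  also have "\<dots> \<le> (1 - \<eta>) * (d * (s\<^sup>2 / n))"
  proof (intro mult_left_mono)
    have "\<tau> \<le> s / n" using \<tau>(3) assms by (simp add: field_simps)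
    then have "\<tau> * s \<le> s / n * s" using assms by (intro mult_right_mono) auto
    then show "\<tau> * s \<le> s\<^sup>2 / n" by (simp add: power2_eq_square)
  qed (use assms in auto)
  finally have "(1 - \<eta>) * (1 + \<epsilon> / 2) * (2 * ln d) * s \<le> x" by (simp add: x(1))
  then have "2 * s * ln d + (2 - x) \<le> 2 - c * s" by (simp add: c(1) algebra_simps)
  also have "\<dots> \<le> 2 + - (c * \<tau>) * n" using mult_left_mono[OF \<tau>(3) c(2)] by (simp add: mult_ac)
  finally have 3: "2 * s * ln d + (2 - x) \<le> 2 + - (c * \<tau>) * n" .
  have "(exp 1 * n / s) ^ (2 * k) * (x * exp (2 - x)) \<le> exp (2 * s * ln d) * (x * exp (2 - x))"
    using 1 x(2) by (intro mult_right_mono) auto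
  also have "\<dots> = x * exp (2 * s * ln d + (2 - x))" by (simp only: exp_add mult_ac)
  also have "\<dots> \<le> d * n * exp (2 + - (c * \<tau>) * n)"
    using 2 3 x(2) assms by (intro mult_mono) auto
  finally show ?thesis by (simp only: exp_add mult_ac)
qed

section \<open>Random subsets\<close>

text \<open>The expectation of \<open>f W\<close> when every element of \<open>V\<close> enters
  \<open>W\<close> independently with probability \<open>p\<close>, written as a finite sum. The
  identities below hold for every real \<open>p\<close>; monotonicity is where \<open>p\<close> has
  to be a probability.\<close>

definition subset_expectation :: "real \<Rightarrow> 'a set \<Rightarrow> ('a set \<Rightarrow> real) \<Rightarrow> real" where
  "subset_expectation p V f = (\<Sum>W\<in>Pow V. (\<Prod>v\<in>V. if v \<in> W then p else 1 - p) * f W)"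

lemma subset_expectation_empty [simp]: "subset_expectation p {} f = f {}"
  by (simp add: subset_expectation_def)

lemma subset_expectation_cong:
  "(\<And>W. W \<subseteq> V \<Longrightarrow> f W = g W) \<Longrightarrow> subset_expectation p V f = subset_expectation p V g"
  unfolding subset_expectation_def by (intro sum.cong) auto

text \<open>Conditioning on whether \<open>a\<close> is chosen; this recursion drives the inductions
  on the ground set.\<close>

lemma subset_expectation_insert:
  assumes "finite V" "a \<notin> V"
  shows "subset_expectation p (insert a V) f
    = p * subset_expectation p V (\<lambda>W. f (insert a W)) + (1 - p) * subset_expectation p V f"
proof -
  let ?t = "\<lambda>V W. (\<Prod>v\<in>V. if v \<in> W then p else 1 - p)"
  have 1: "?t (insert a V) W = (1 - p) * ?t V W" if "W \<subseteq> V" for W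
    using assms that by (auto simp: prod.insert)
  have 2: "?t (insert a V) (insert a W) = p * ?t V W" for W
  proof -
    have "?t V (insert a W) = ?t V W" using assms by (intro prod.cong) auto
    then show ?thesis using assms by (simp add: prod.insert)
  qed
  have "subset_expectation p (insert a V) f
      = (\<Sum>W\<in>Pow V. ?t (insert a V) W * f W) + (\<Sum>W\<in>insert a ` Pow V. ?t (insert a V) W * f W)"
    unfolding subset_expectation_def Pow_insert using assms by (intro sum.union_disjoint) auto
  also have "(\<Sum>W\<in>insert a ` Pow V. ?t (insert a V) W * f W)
      = (\<Sum>W\<in>Pow V. ?t (insert a V) (insert a W) * f (insert a W))"
  proof (rule sum.reindex[unfolded o_def])
    show "inj_on (insert a) (Pow V)" using assms(2) by (intro inj_onI) (metis PowD insert_ident subsetD)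
  qed
  also have "\<dots> = p * subset_expectation p V (\<lambda>W. f (insert a W))"
    unfolding subset_expectation_def 2 by (simp add: sum_distrib_left mult.assoc)
  also have "(\<Sum>W\<in>Pow V. ?t (insert a V) W * f W) = (1 - p) * subset_expectation p V f"
    unfolding subset_expectation_def sum_distrib_left
    by (intro sum.cong refl) (use 1 in \<open>auto simp: mult.assoc\<close>)
  finally show ?thesis by simp
qed

lemma subset_expectation_indep:
  assumes "finite A" "finite B" "A \<inter> B = {}"
  shows "subset_expectation p (A \<union> B) (\<lambda>W. f (W \<inter> A) * g (W \<inter> B))
    = subset_expectation p A f * subset_expectation p B g"
  using assms
proof (induction A arbitrary: f rule: finite_induct)
  case empty
  have "subset_expectation p B (\<lambda>W. f (W \<inter> {}) * g (W \<inter> B)) = subset_expectation p B (\<lambda>W. f {} * g W)"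
    by (rule subset_expectation_cong) (simp add: Int_absorb2)
  then show ?case by (simp add: subset_expectation_def sum_distrib_left mult_ac)
next
  case (insert a A)
  let ?h = "\<lambda>W. f (W \<inter> insert a A) * g (W \<inter> B)"
  have a: "a \<notin> A \<union> B" using insert by auto
  have "subset_expectation p (A \<union> B) (\<lambda>W. ?h (insert a W))
      = subset_expectation p (A \<union> B) (\<lambda>W. f (insert a (W \<inter> A)) * g (W \<inter> B))"
    using a by (intro subset_expectation_cong) (auto simp: Int_insert_left Int_insert_right)
  also have "\<dots> = subset_expectation p A (\<lambda>W. f (insert a W)) * subset_expectation p B g"
    using insert by (intro insert.IH) auto
  finally have 1: "subset_expectation p (A \<union> B) (\<lambda>W. ?h (insert a W))
      = subset_expectation p A (\<lambda>W. f (insert a W)) * subset_expectation p B g" .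
  have "subset_expectation p (A \<union> B) ?h = subset_expectation p (A \<union> B) (\<lambda>W. f (W \<inter> A) * g (W \<inter> B))"
  proof (rule subset_expectation_cong)
    fix W assume "W \<subseteq> A \<union> B"
    then have "a \<notin> W" using a by auto
    then show "?h W = f (W \<inter> A) * g (W \<inter> B)" by (simp add: Int_insert_right)
  qed
  also have "\<dots> = subset_expectation p A f * subset_expectation p B g"
    using insert by (intro insert.IH) auto
  finally have 2: "subset_expectation p (A \<union> B) ?h = subset_expectation p A f * subset_expectation p B g" .
  have "subset_expectation p (insert a (A \<union> B)) ?h
      = p * subset_expectation p (A \<union> B) (\<lambda>W. ?h (insert a W)) + (1 - p) * subset_expectation p (A \<union> B) ?h"
    using insert.hyps(1) insert.prems(1) a by (intro subset_expectation_insert) auto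
  then show ?case
    unfolding Un_insert_left 1 2 subset_expectation_insert[OF insert.hyps] by (simp add: algebra_simps)
qed

lemma subset_expectation_const: "finite V \<Longrightarrow> subset_expectation p V (\<lambda>_. c) = c"
  by (induction V rule: finite_induct) (auto simp: subset_expectation_insert algebra_simps)

lemma subset_expectation_restrict:
  assumes "finite V" "U \<subseteq> V"
  shows "subset_expectation p V (\<lambda>W. f (W \<inter> U)) = subset_expectation p U f"
proof -
  have "subset_expectation p (U \<union> (V - U)) (\<lambda>W. f (W \<inter> U) * (\<lambda>_. 1) (W \<inter> (V - U)))
      = subset_expectation p U f * subset_expectation p (V - U) (\<lambda>_. 1)"
    using assms by (intro subset_expectation_indep) (auto intro: finite_subset)
  moreover have "U \<union> (V - U) = V" using assms by auto
  ultimately show ?thesis using assms by (simp add: subset_expectation_const)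
qed

lemma subset_expectation_sum:
  "subset_expectation p V (\<lambda>W. \<Sum>i\<in>I. f i W) = (\<Sum>i\<in>I. subset_expectation p V (f i))"
  unfolding subset_expectation_def sum_distrib_left by (rule sum.swap)

lemma subset_expectation_diff:
  "subset_expectation p V (\<lambda>W. f W - g W) = subset_expectation p V f - subset_expectation p V g"
  by (simp add: subset_expectation_def sum_subtractf algebra_simps)

lemma subset_expectation_mono:
  assumes "0 \<le> p" "p \<le> 1" "\<And>W. W \<subseteq> V \<Longrightarrow> f W \<le> g W"
  shows "subset_expectation p V f \<le> subset_expectation p V g"
  unfolding subset_expectation_def using assms by (intro sum_mono mult_left_mono prod_nonneg) auto

text \<open>The first moment method: an average never exceeds the maximum.\<close>

lemma subset_expectation_attained:
  assumes "0 \<le> p" "p \<le> 1" "finite V"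
  shows "\<exists>W\<subseteq>V. subset_expectation p V f \<le> f W"
proof -
  let ?m = "Max (f ` Pow V)"
  have fin: "finite (f ` Pow V)" "f ` Pow V \<noteq> {}" using assms by auto
  have "subset_expectation p V f \<le> subset_expectation p V (\<lambda>_. ?m)"
    using assms fin by (intro subset_expectation_mono) auto
  also have "\<dots> = ?m" by (rule subset_expectation_const[OF assms(3)])
  finally have "subset_expectation p V f \<le> ?m" .
  moreover obtain W where "W \<in> Pow V" "?m = f W" using Max_in[OF fin] by auto
  ultimately show ?thesis by auto
qed

lemma subset_expectation_eq_empty:
  "finite V \<Longrightarrow> subset_expectation p V (\<lambda>W. of_bool (W = {})) = (1 - p) ^ card V"
  by (induction V rule: finite_induct) (auto simp: subset_expectation_insert subset_expectation_const)

text \<open>Disjoint blocks are hit independently, and a block is missed with probability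
  \<open>(1 - p) ^ card (B i)\<close>.\<close>

lemma subset_expectation_hits_all:
  assumes "finite I" "\<And>i. i \<in> I \<Longrightarrow> finite (B i)"
    "\<And>i j. i \<in> I \<Longrightarrow> j \<in> I \<Longrightarrow> i \<noteq> j \<Longrightarrow> B i \<inter> B j = {}"
  shows "subset_expectation p (\<Union>i\<in>I. B i) (\<lambda>W. of_bool (\<forall>i\<in>I. W \<inter> B i \<noteq> {}))
    = (\<Prod>i\<in>I. 1 - (1 - p) ^ card (B i))"
  using assms
proof (induction I rule: finite_induct)
  case (insert a I)
  let ?U = "\<Union>i\<in>I. B i"
  have "subset_expectation p (B a \<union> ?U) (\<lambda>W. of_bool (\<forall>i\<in>insert a I. W \<inter> B i \<noteq> {}))
      = subset_expectation p (B a \<union> ?U)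
        (\<lambda>W. (\<lambda>X. 1 - of_bool (X = {})) (W \<inter> B a) * (\<lambda>X. of_bool (\<forall>i\<in>I. X \<inter> B i \<noteq> {})) (W \<inter> ?U))"
  proof (rule subset_expectation_cong)
    fix W
    have "W \<inter> ?U \<inter> B i = W \<inter> B i" if "i \<in> I" for i using that by auto
    then show "of_bool (\<forall>i\<in>insert a I. W \<inter> B i \<noteq> {})
      = (\<lambda>X. 1 - of_bool (X = {}) :: real) (W \<inter> B a) * (\<lambda>X. of_bool (\<forall>i\<in>I. X \<inter> B i \<noteq> {})) (W \<inter> ?U)"
      by auto
  qed
  also have "\<dots> = subset_expectation p (B a) (\<lambda>X. 1 - of_bool (X = {}))
      * subset_expectation p ?U (\<lambda>X. of_bool (\<forall>i\<in>I. X \<inter> B i \<noteq> {}))"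
  proof (rule subset_expectation_indep)
    show "finite (B a)" "finite ?U" using insert by auto
    have "B a \<inter> B i = {}" if "i \<in> I" for i using insert that by (metis insertCI)
    then show "B a \<inter> ?U = {}" by blast
  qed
  also have "subset_expectation p (B a) (\<lambda>X. 1 - of_bool (X = {})) = 1 - (1 - p) ^ card (B a)"
    using insert by (simp add: subset_expectation_diff subset_expectation_const subset_expectation_eq_empty)
  also have "subset_expectation p ?U (\<lambda>X. of_bool (\<forall>i\<in>I. X \<inter> B i \<noteq> {})) = (\<Prod>i\<in>I. 1 - (1 - p) ^ card (B i))"
    using insert by (intro insert.IH) auto
  finally show ?case using insert by simp
qed simp

section \<open>Regular graphs and switchings\<close>

lemma doubleton_in_all_pairs [simp]: "{u, v} \<in> all_pairs n \<longleftrightarrow> u < n \<and> v < n \<and> u \<noteq> v"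
  by (auto simp: all_pairs_def doubleton_eq_iff)

lemma finite_all_pairs: "finite (all_pairs n)"
  by (rule finite_subset[of _ "Pow {0..<n}"]) (auto simp: all_pairs_def)

lemma finite_regular_graphs: "finite (regular_graphs n d)"
  by (rule finite_subset[of _ "Pow (all_pairs n)"])
    (auto simp: regular_graphs_def finite_all_pairs)

text \<open>Every edge appears in both orientations, because a switching has to know which end of a
  chosen edge is joined to which vertex.\<close>

definition arcs :: "nat set set \<Rightarrow> (nat \<times> nat) set" where
  "arcs E = {(p, q). {p, q} \<in> E}"

lemma arcs_iff [simp]: "(p, q) \<in> arcs E \<longleftrightarrow> {p, q} \<in> E"
  by (simp add: arcs_def)

lemma card_incident_eq_degree:
  assumes "E \<subseteq> all_pairs n"
  shows "card {e \<in> E. v \<in> e} = card {u. {v, u} \<in> E}"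
proof (rule sym, rule bij_betw_same_card)
  show "bij_betw (\<lambda>u. {v, u}) {u. {v, u} \<in> E} {e \<in> E. v \<in> e}"
    unfolding bij_betw_def
  proof
    show "inj_on (\<lambda>u. {v, u}) {u. {v, u} \<in> E}"
      by (auto simp: inj_on_def doubleton_eq_iff)
    show "(\<lambda>u. {v, u}) ` {u. {v, u} \<in> E} = {e \<in> E. v \<in> e}"
    proof (intro equalityI subsetI)
      fix e assume "e \<in> {e \<in> E. v \<in> e}"
      moreover from this obtain a b where "e = {a, b}"
        using assms by (auto simp: all_pairs_def)
      ultimately show "e \<in> (\<lambda>u. {v, u}) ` {u. {v, u} \<in> E}"
        by (auto simp: insert_commute)
    qed auto
  qed
qed

lemma card_incident_conv_sum:
  "finite E \<Longrightarrow> card {e \<in> E. z \<in> e} = (\<Sum>e\<in>E. of_bool (z \<in> e))"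
  by (simp add: Int_def)

text \<open>For disjoint \<open>A\<close> and \<open>B\<close> an edge contributes at most one pair,
  so the cardinality then counts edges between the two sets.\<close>

definition crossing :: "nat set \<Rightarrow> nat set \<Rightarrow> nat set set \<Rightarrow> (nat \<times> nat) set" where
  "crossing A B E = {(x, y). x \<in> A \<and> y \<in> B \<and> {x, y} \<in> E}"

lemma edge_bounds:
  assumes regular: "E \<in> regular_graphs n d" and edge: "{u, v} \<in> E"
  shows "u < n" "v < n" "u \<noteq> v"
proof -
  have "E \<subseteq> all_pairs n" using regular by (simp add: regular_graphs_def)
  then have "{u, v} \<in> all_pairs n" using edge by (rule subsetD)
  then show "u < n" "v < n" "u \<noteq> v" by auto
qed

lemma finite_regular_graph:
  assumes regular: "E \<in> regular_graphs n d"
  shows "finite E" "finite {u. {v, u} \<in> E}" "finite (arcs E)" "finite (crossing A B E)"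
proof -
  note edge_bounds = edge_bounds[OF regular]
  show "finite E" using regular finite_all_pairs by (auto simp: regular_graphs_def intro: finite_subset)
  show "finite {u. {v, u} \<in> E}" by (rule finite_subset[of _ "{0..<n}"]) (auto dest: edge_bounds)
  show "finite (arcs E)"
    by (rule finite_subset[of _ "{0..<n} \<times> {0..<n}"]) (auto dest: edge_bounds)
  then show "finite (crossing A B E)" by (rule rev_finite_subset) (auto simp: crossing_def)
qed

lemma card_nbrs: "E \<in> regular_graphs n d \<Longrightarrow> v < n \<Longrightarrow> card {u. {v, u} \<in> E} = d"
  by (auto simp: regular_graphs_def)

lemma card_nbrs_le:
  assumes regular: "E \<in> regular_graphs n d"
  shows "card {u. {v, u} \<in> E} \<le> d"
proof (cases "v < n")
  case False
  then have "{u. {v, u} \<in> E} = {}" by (auto dest: edge_bounds[OF regular])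
  then show ?thesis by (metis card.empty zero_le)
qed (simp add: card_nbrs[OF regular])

lemma card_arcs:
  assumes regular: "E \<in> regular_graphs n d"
  shows "card (arcs E) = n * d"
proof -
  have "arcs E = Sigma {0..<n} (\<lambda>v. {u. {v, u} \<in> E})" by (auto dest: edge_bounds[OF regular])
  then show ?thesis
    by (simp add: card_SigmaI card_nbrs[OF regular] finite_regular_graph[OF regular])
qed

lemma card_arcs_from_le:
  assumes regular: "E \<in> regular_graphs n d" and "finite X"
  shows "card {(p, q). {p, q} \<in> E \<and> p \<in> X} \<le> card X * d"
proof -
  have "{(p, q). {p, q} \<in> E \<and> p \<in> X} = Sigma X (\<lambda>v. {u. {v, u} \<in> E})" by auto
  then have "card {(p, q). {p, q} \<in> E \<and> p \<in> X} = (\<Sum>v\<in>X. card {u. {v, u} \<in> E})"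
    using assms(2) by (simp add: card_SigmaI finite_regular_graph[OF regular])
  also have "\<dots> \<le> (\<Sum>v\<in>X. d)" by (intro sum_mono card_nbrs_le[OF regular])
  finally show ?thesis by simp
qed

lemma card_arcs_to_le:
  assumes regular: "E \<in> regular_graphs n d" and "finite X"
  shows "card {(p, q). {p, q} \<in> E \<and> q \<in> X} \<le> card X * d"
proof -
  have "{(p, q). {p, q} \<in> E \<and> q \<in> X} = prod.swap ` {(p, q). {p, q} \<in> E \<and> p \<in> X}"
    by (auto simp: image_iff insert_commute)
  then show ?thesis
    using card_arcs_from_le[OF assms] by (simp add: card_image)
qed

lemma card_closed_nbhd_le:
  assumes regular: "E \<in> regular_graphs n d"
  shows "card (insert v {u. {v, u} \<in> E}) \<le> d + 1"
  using card_insert_le_m1[of "d + 1" "{u. {v, u} \<in> E}" v] card_nbrs_le[OF regular, of v] by simp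

text \<open>By \<open>inc\<close> every vertex lies on as many removed as added edges. Since
  \<open>R\<close> is contained in \<open>E\<close> and \<open>A\<close> is disjoint from it, these
  numbers are subtracted and added without overlap, and degrees are preserved.\<close>

lemma switch:
  assumes regular: "E \<in> regular_graphs n d" and "R \<subseteq> E" and "A \<inter> E = {}" and "A \<subseteq> all_pairs n"
    and inc: "\<And>z. (\<Sum>e\<in>R. of_bool (z \<in> e) :: nat) = (\<Sum>e\<in>A. of_bool (z \<in> e))"
  shows "E - R \<union> A \<in> regular_graphs n d"
proof -
  note finite_edges = finite_regular_graph(1)[OF regular] and card_nbrs = card_nbrs[OF regular]
  have sub: "E \<subseteq> all_pairs n" using regular by (auto simp: regular_graphs_def)
  then have sub': "E - R \<union> A \<subseteq> all_pairs n" using assms by auto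
  have "card {u. {z, u} \<in> E - R \<union> A} = d" if "z < n" for z
  proof -
    have fin: "finite {e \<in> E. z \<in> e}" "finite A"
      using finite_edges assms(4) finite_all_pairs finite_subset by auto
    have "finite R" using assms(2) finite_edges by (rule finite_subset)
    then have inc': "card {e \<in> R. z \<in> e} = card {e \<in> A. z \<in> e}"
      using inc[of z] fin(2) by (simp add: card_incident_conv_sum)
    have "{e \<in> E - R \<union> A. z \<in> e} = ({e \<in> E. z \<in> e} - {e \<in> R. z \<in> e}) \<union> {e \<in> A. z \<in> e}"
      by auto
    then have "card {e \<in> E - R \<union> A. z \<in> e}
        = card ({e \<in> E. z \<in> e} - {e \<in> R. z \<in> e}) + card {e \<in> A. z \<in> e}"
      using fin assms(3) by (subst card_Un_disjoint[symmetric]) auto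
    also have "card ({e \<in> E. z \<in> e} - {e \<in> R. z \<in> e}) = card {e \<in> E. z \<in> e} - card {e \<in> R. z \<in> e}"
      using fin assms(2) by (intro card_Diff_subset) (auto intro: finite_subset[OF _ finite_edges])
    also have "\<dots> + card {e \<in> A. z \<in> e} = card {e \<in> E. z \<in> e}"
    proof -
      have "card {e \<in> R. z \<in> e} \<le> card {e \<in> E. z \<in> e}"
        using assms(2) by (intro card_mono fin) auto
      then show ?thesis using inc' by simp
    qed
    finally have "card {e \<in> E - R \<union> A. z \<in> e} = card {e \<in> E. z \<in> e}" .
    then show ?thesis
      using card_incident_eq_degree[OF sub', of z] card_incident_eq_degree[OF sub, of z]
        card_nbrs[OF that] by simp
  qed
  then show ?thesis using sub' by (auto simp: regular_graphs_def)
qed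

lemma of_bool_mem_doubleton:
  "a \<noteq> b \<Longrightarrow> (of_bool (z \<in> {a, b}) :: nat) = of_bool (z = a) + of_bool (z = b)"
  by auto

text \<open>Both sides count how often \<open>z\<close> occurs among the same four endpoints; the
  inequalities keep edges from degenerating to loops or coinciding.\<close>

lemma incidence_pair_switch:
  assumes "a \<noteq> b" "p \<noteq> q" "a \<noteq> p" "b \<noteq> q" "{a, b} \<noteq> {p, q}" "{a, p} \<noteq> {b, q}"
  shows "(\<Sum>e\<in>{{a, b}, {p, q}}. of_bool (z \<in> e) :: nat) = (\<Sum>e\<in>{{a, p}, {b, q}}. of_bool (z \<in> e))"
proof -
  have "(\<Sum>e\<in>{X, Y}. of_bool (z \<in> e) :: nat) = of_bool (z \<in> X) + of_bool (z \<in> Y)"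
    if "X \<noteq> Y" for X Y using that by simp
  then show ?thesis using assms by (simp only: of_bool_mem_doubleton not_False_eq_True)
qed

lemma incidence_triple_switch:
  assumes "x \<noteq> v" "y \<noteq> u" "p \<noteq> q" "x \<noteq> y" "v \<noteq> p" "u \<noteq> q"
    "{x, v} \<noteq> {y, u}" "{x, v} \<noteq> {p, q}" "{y, u} \<noteq> {p, q}"
    "{x, y} \<noteq> {v, p}" "{x, y} \<noteq> {u, q}" "{v, p} \<noteq> {u, q}"
  shows "(\<Sum>e\<in>{{x, v}, {y, u}, {p, q}}. of_bool (z \<in> e) :: nat)
    = (\<Sum>e\<in>{{x, y}, {v, p}, {u, q}}. of_bool (z \<in> e))"
proof -
  have "(\<Sum>e\<in>{X, Y, Z}. of_bool (z \<in> e) :: nat) = of_bool (z \<in> X) + of_bool (z \<in> Y) + of_bool (z \<in> Z)"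
    if "X \<noteq> Y" "X \<noteq> Z" "Y \<noteq> Z" for X Y Z using that by simp
  then show ?thesis using assms by (simp only: of_bool_mem_doubleton not_False_eq_True)
qed

text \<open>A switching step (\<open>G\<close>, \<open>t\<close>) \<open>\<mapsto>\<close> (\<open>f G t\<close>, \<open>t\<close>) that is undone by \<open>g\<close> is injective, so the
  number of steps leaving \<open>X\<close> is at most the number of steps entering \<open>Y\<close>.\<close>

lemma switching_double_count:
  assumes "finite X" "finite Y" "\<And>G. G \<in> Y \<Longrightarrow> finite (T' G)"
    and lower: "\<And>G. G \<in> X \<Longrightarrow> finite (T G) \<and> a \<le> real (card (T G))"
    and upper: "\<And>G. G \<in> Y \<Longrightarrow> real (card (T' G)) \<le> b"
    and f: "\<And>G t. G \<in> X \<Longrightarrow> t \<in> T G \<Longrightarrow> f G t \<in> Y \<and> t \<in> T' (f G t) \<and> g (f G t) t = G"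
  shows "real (card X) * a \<le> real (card Y) * b"
proof -
  have "real (card X) * a = (\<Sum>G\<in>X. a)" by simp
  also have "\<dots> \<le> (\<Sum>G\<in>X. real (card (T G)))" using lower by (intro sum_mono) auto
  also have "\<dots> = real (card (Sigma X T))" using lower assms(1) by (simp add: card_SigmaI)
  also have "card (Sigma X T) \<le> card (Sigma Y T')"
  proof (rule card_inj_on_le[of "\<lambda>(G, t). (f G t, t)"])
    show "inj_on (\<lambda>(G, t). (f G t, t)) (Sigma X T)"
    proof (rule inj_onI, clarify)
      fix G t G' assume "G \<in> X" "t \<in> T G" "G' \<in> X" "t \<in> T G'" "f G t = f G' t"
      then show "G = G' \<and> t = t" using f by metis
    qed
    show "(\<lambda>(G, t). (f G t, t)) ` Sigma X T \<subseteq> Sigma Y T'" using f by auto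
    show "finite (Sigma Y T')" using assms by auto
  qed
  also have "real (card (Sigma Y T')) = (\<Sum>G\<in>Y. real (card (T' G)))"
    using assms by (simp add: card_SigmaI)
  also have "\<dots> \<le> (\<Sum>G\<in>Y. b)" using upper by (intro sum_mono) auto
  finally show ?thesis by simp
qed

lemma undo_switch: "R \<subseteq> E \<Longrightarrow> A \<inter> E = {} \<Longrightarrow> (E - R \<union> A) - A \<union> R = E"
  by auto

section \<open>Probability of containing prescribed edges\<close>

lemma card_arcs_le:
  assumes "finite F"
  shows "finite (arcs F)" and "card (arcs F) \<le> 2 * card F"
proof -
  have *: "finite {(p, q). e = {p, q}} \<and> card {(p, q). e = {p, q}} \<le> 2" for e :: "nat set"
  proof (cases "\<exists>a b. e = {a, b}")
    case True
    then obtain a b where e: "e = {a, b}" by blast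
    have sub: "{(p, q). e = {p, q}} \<subseteq> {(a, b), (b, a)}"
      unfolding e doubleton_eq_iff by blast
    have "card {(a, b), (b, a)} \<le> 2" using card_length[of "[(a, b), (b, a)]"] by simp
    then show ?thesis using card_mono[OF _ sub] finite_subset[OF sub] by (meson finite.intros le_trans)
  next
    case False
    then have "{(p, q). e = {p, q}} = {}" by auto
    then show ?thesis by (metis card.empty finite.emptyI zero_le)
  qed
  have eq: "arcs F = (\<Union>e\<in>F. {(p, q). e = {p, q}})" by auto
  show "finite (arcs F)" unfolding eq using assms * by (intro finite_UN_I) auto
  have "card (arcs F) \<le> (\<Sum>e\<in>F. card {(p, q). e = {p, q}})"
    unfolding eq by (rule card_UN_le[OF assms])
  also have "\<dots> \<le> (\<Sum>e\<in>F. 2)" by (intro sum_mono) (use * in auto)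
  finally show "card (arcs F) \<le> 2 * card F" by simp
qed

lemma card_Diff_ge: "finite B \<Longrightarrow> real (card A) - real (card B) \<le> real (card (A - B))"
  using diff_card_le_card_Diff[of B A] by linarith

text \<open>Replacing \<open>uv\<close> and \<open>pq\<close> by \<open>up\<close> and
  \<open>vq\<close> destroys the edge \<open>uv\<close> and keeps \<open>F\<close>. Of the
  \<open>n * d\<close> arcs, at most \<open>(d + 1) * d\<close> start in the closed neighbourhood of
  \<open>u\<close>, as many end in that of \<open>v\<close>, and \<open>2 * card F\<close> lie in
  \<open>F\<close>. In the reverse direction \<open>p\<close> and \<open>q\<close> are neighbours of
  \<open>u\<close> and \<open>v\<close>, which gives at most \<open>d * d\<close> choices.\<close>

lemma card_graphs_with_edge:
  fixes u v n d :: nat and F :: "nat set set"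
  assumes "finite F" and "{u, v} \<notin> F"
  shows "real (card {E \<in> regular_graphs n d. insert {u, v} F \<subseteq> E})
      * (real n * d - 2 * ((d + 1) * d) - 2 * card F)
    \<le> real (card {E \<in> regular_graphs n d. F \<subseteq> E}) * (d * d)"
proof (rule switching_double_count[where
      f = "\<lambda>E (p, q). E - {{u, v}, {p, q}} \<union> {{u, p}, {v, q}}" and
      g = "\<lambda>E (p, q). E - {{u, p}, {v, q}} \<union> {{u, v}, {p, q}}" and
      T = "\<lambda>E. arcs E - {(p, q). {p, q} \<in> E \<and> p \<in> insert u {w. {u, w} \<in> E}}
        - {(p, q). {p, q} \<in> E \<and> q \<in> insert v {w. {v, w} \<in> E}} - arcs F" and
      T' = "\<lambda>E. {p. {u, p} \<in> E} \<times> {q. {v, q} \<in> E}"])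
  show "finite {E \<in> regular_graphs n d. insert {u, v} F \<subseteq> E}"
    "finite {E \<in> regular_graphs n d. F \<subseteq> E}"
    using finite_regular_graphs by auto
next
  fix E assume "E \<in> {E \<in> regular_graphs n d. F \<subseteq> E}"
  then have regular: "E \<in> regular_graphs n d" by simp
  note [simp] = finite_regular_graph[OF regular]
  note card_nbrs_le = card_nbrs_le[OF regular]
  show "finite ({p. {u, p} \<in> E} \<times> {q. {v, q} \<in> E})" by simp
  have "card ({p. {u, p} \<in> E} \<times> {q. {v, q} \<in> E}) \<le> d * d"
    unfolding card_cartesian_product by (intro mult_mono card_nbrs_le) auto
  then show "real (card ({p. {u, p} \<in> E} \<times> {q. {v, q} \<in> E})) \<le> real (d * d)"
    by (simp only: of_nat_le_iff)
next
  fix E assume E: "E \<in> {E \<in> regular_graphs n d. insert {u, v} F \<subseteq> E}"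
  then have regular: "E \<in> regular_graphs n d" by simp
  note [simp] = finite_regular_graph[OF regular]
  note edge_bounds = edge_bounds[OF regular] and card_arcs = card_arcs[OF regular]
    and card_arcs_from_le = card_arcs_from_le[OF regular]
    and card_arcs_to_le = card_arcs_to_le[OF regular]
    and card_closed_nbhd_le = card_closed_nbhd_le[OF regular] and switch = switch[OF regular]
    and finite_arcs = finite_regular_graph(3)[OF regular]
  let ?X = "{(p, q). {p, q} \<in> E \<and> p \<in> insert u {w. {u, w} \<in> E}}"
  let ?Y = "{(p, q). {p, q} \<in> E \<and> q \<in> insert v {w. {v, w} \<in> E}}"
  have fin: "finite ?X" "finite ?Y"
    by (rule finite_subset[OF _ finite_arcs], auto)+
  have "card ?X \<le> card (insert u {w. {u, w} \<in> E}) * d"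
    by (rule card_arcs_from_le) simp
  also have "\<dots> \<le> (d + 1) * d" by (intro mult_right_mono card_closed_nbhd_le) simp
  finally have X: "real (card ?X) \<le> (d + 1) * d" by (simp only: of_nat_le_iff)
  have "card ?Y \<le> card (insert v {w. {v, w} \<in> E}) * d"
    by (rule card_arcs_to_le) simp
  also have "\<dots> \<le> (d + 1) * d" by (intro mult_right_mono card_closed_nbhd_le) simp
  finally have Y: "real (card ?Y) \<le> (d + 1) * d" by (simp only: of_nat_le_iff)
  have "real (n * d) - card ?X \<le> card (arcs E - ?X)"
    using card_Diff_ge[OF fin(1), of "arcs E"] card_arcs by simp
  moreover have "real (card (arcs E - ?X)) - card ?Y \<le> card (arcs E - ?X - ?Y)"
    by (rule card_Diff_ge[OF fin(2)])
  moreover have "real (card (arcs E - ?X - ?Y)) - card (arcs F) \<le> card (arcs E - ?X - ?Y - arcs F)"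
    by (rule card_Diff_ge[OF card_arcs_le(1)[OF assms(1)]])
  moreover have "real (card (arcs F)) \<le> 2 * card F"
    using card_arcs_le(2)[OF assms(1)] by (simp only: of_nat_le_iff)
  ultimately show "finite (arcs E - ?X - ?Y - arcs F) \<and>
     real n * d - 2 * ((d + 1) * d) - 2 * card F \<le> real (card (arcs E - ?X - ?Y - arcs F))"
    using X Y by (simp add: mult.commute)
  fix t assume t: "t \<in> arcs E - ?X - ?Y - arcs F"
  obtain p q where pq: "t = (p, q)" by (cases t)
  let ?R = "{{u, v}, {p, q}}" and ?A = "{{u, p}, {v, q}}"
  have uv: "{u, v} \<in> E" "F \<subseteq> E" using E by auto
  have h: "{p, q} \<in> E" "p \<noteq> u" "{u, p} \<notin> E" "q \<noteq> v" "{v, q} \<notin> E" "{p, q} \<notin> F"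
    using t pq by auto
  \<comment> \<open>As \<open>v\<close> is a neighbour of \<open>u\<close>, keeping \<open>p\<close>
    outside the closed neighbourhood of \<open>u\<close> also rules out \<open>p = v\<close>; the
    same holds for \<open>q\<close> and \<open>u\<close>.\<close>
  have h2: "p \<noteq> v" "q \<noteq> u" "p \<noteq> q" "u \<noteq> v"
    using h uv(1) edge_bounds(3)[of p q] edge_bounds(3)[of u v] insert_commute[of u v "{}"] by metis+
  have b: "u < n" "v < n" "p < n" "q < n" using edge_bounds[OF h(1)] edge_bounds[OF uv(1)] by simp_all
  have sub: "?R \<subseteq> E" and dis: "?A \<inter> E = {}" using h uv by auto
  have "E - ?R \<union> ?A \<in> regular_graphs n d"
  proof (rule switch[OF sub dis])
    show "?A \<subseteq> all_pairs n" using b h h2 by auto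
    show "(\<Sum>e\<in>?R. of_bool (z \<in> e) :: nat) = (\<Sum>e\<in>?A. of_bool (z \<in> e))" for z
      by (rule incidence_pair_switch) (use h h2 in \<open>simp_all (no_asm_simp) add: doubleton_eq_iff\<close>)
  qed
  moreover have "F \<subseteq> E - ?R \<union> ?A" using uv h assms by auto
  ultimately show "(case t of (p, q) \<Rightarrow> E - {{u, v}, {p, q}} \<union> {{u, p}, {v, q}})
        \<in> {E \<in> regular_graphs n d. F \<subseteq> E} \<and>
      t \<in> {p. {u, p} \<in> (case t of (p, q) \<Rightarrow> E - {{u, v}, {p, q}} \<union> {{u, p}, {v, q}})}
        \<times> {q. {v, q} \<in> (case t of (p, q) \<Rightarrow> E - {{u, v}, {p, q}} \<union> {{u, p}, {v, q}})} \<and>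
      (case t of (p, q) \<Rightarrow> (case t of (p, q) \<Rightarrow> E - {{u, v}, {p, q}} \<union> {{u, p}, {v, q}})
        - {{u, p}, {v, q}} \<union> {{u, v}, {p, q}}) = E"
    unfolding pq prod.case using undo_switch[OF sub dis] by blast
qed

text \<open>The edges of \<open>F\<close> are exposed one at a time. For such \<open>n\<close> at
  least half of all arcs can be used in the switching, so each edge costs a factor of at most
  \<open>2 * d / n\<close>, twice the heuristic edge probability \<open>d / n\<close>.\<close>

lemma card_graphs_containing:
  fixes n d :: nat
  assumes "finite F" "card F \<le> k" "F \<subseteq> all_pairs n" "4 * (d + 1) + 4 * k \<le> n"
  shows "real (card {E \<in> regular_graphs n d. F \<subseteq> E})
    \<le> (2 * d / n) ^ card F * card (regular_graphs n d)"
  using assms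
proof (induction F rule: finite_induct)
  case empty
  then show ?case by simp
next
  case (insert e F)
  then obtain u v where e: "e = {u, v}" by (auto simp: all_pairs_def)
  let ?N = "\<lambda>F. real (card {E \<in> regular_graphs n d. F \<subseteq> E})"
  have cF: "card F < k" using insert by simp
  show ?case
  \<comment> \<open>The case \<open>d = 0\<close> stands apart because the estimate
    \<open>card F \<le> k * d\<close> and the cancellation of \<open>d\<close> require a positive
    degree.\<close>
  proof (cases "d = 0")
    case True
    have "{E \<in> regular_graphs n d. insert e F \<subseteq> E} = {}"
    proof safe
      fix E assume E: "E \<in> regular_graphs n d" "insert e F \<subseteq> E"
      then have regular: "E \<in> regular_graphs n d" by simp
      note [simp] = finite_regular_graph[OF regular]
      note card_nbrs_le = card_nbrs_le[OF regular]
        and finite_nbrs = finite_regular_graph(2)[OF regular]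
      have "v \<in> {w. {u, w} \<in> E}" using E e by auto
      moreover have "card {w. {u, w} \<in> E} = 0" using card_nbrs_le[of u] True by simp
      ultimately show "E \<in> {}" using card_0_eq[OF finite_nbrs[of u]] by auto
    qed
    then show ?thesis by (simp only: card.empty of_nat_0) simp
  next
    case False
    have n: "n > 0" using insert.prems by simp
    have "real n * d / 2 \<le> real n * d - 2 * ((d + 1) * d) - 2 * card F"
    proof -
      have "4 * ((d + 1) * d) + 4 * card F \<le> (4 * (d + 1) + 4 * k) * d"
      proof -
        have "card F * 1 \<le> k * d" using cF False by (intro mult_mono) auto
        then show ?thesis by (simp add: algebra_simps)
      qed
      also have "\<dots> \<le> n * d" using insert.prems by (intro mult_right_mono) auto
      finally have "real (4 * ((d + 1) * d) + 4 * card F) \<le> real (n * d)" by (simp only: of_nat_le_iff)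
      then show ?thesis by (simp add: algebra_simps)
    qed
    then have "?N (insert e F) * (real n * d / 2)
        \<le> ?N (insert e F) * (real n * d - 2 * ((d + 1) * d) - 2 * card F)"
      by (rule mult_left_mono) simp
    also have "\<dots> \<le> ?N F * (d * d)"
      using card_graphs_with_edge[of F u v n d] insert e by simp
    finally have "?N (insert e F) \<le> (2 * d / n) * ?N F"
      using False n by (simp add: field_simps)
    also have "\<dots> \<le> (2 * d / n) * ((2 * d / n) ^ card F * card (regular_graphs n d))"
      using insert by (intro mult_left_mono) auto
    finally show ?thesis using insert by simp
  qed
qed

text \<open>The circulant graph on \<open>\<int>/n\<close> whose connection set consists of the residues within distance \<open>d div 2\<close>
  of \<open>0\<close>, together with \<open>n/2\<close> if \<open>d\<close> is odd.\<close>

lemma regular_graphs_nonempty: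
  assumes "d < n" "even (n * d)"
  shows "regular_graphs n d \<noteq> {}"
proof -
  define k where "k = d div 2"
  define M where "M = (if odd d then {n div 2} else {})"
  define D where "D = {1..k} \<union> {n - k..<n} \<union> M"
  \<comment> \<open>Addition modulo \<open>n\<close>, for summands below \<open>n\<close>.\<close>
  define shift where "shift = (\<lambda>u t. if u + t < n then u + t else u + t - n)"
  define E where "E = {{u, shift u t} | u t. u < n \<and> t \<in> D}"
  have d: "d = 2 * k + (if odd d then 1 else 0)" unfolding k_def by presburger
  have mid: "k < n div 2" "n div 2 < n - k" "2 * (n div 2) = n" if "odd d"
  proof -
    have "even n" using that assms(2) by simp
    then show "2 * (n div 2) = n" by simp
    then show "k < n div 2" "n div 2 < n - k" using d that assms(1) by auto
  qed
  have "card D = card ({1..k} \<union> {n - k..<n}) + card M"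
    unfolding D_def by (rule card_Un_disjoint) (use mid in \<open>auto simp: M_def\<close>)
  also have "card ({1..k} \<union> {n - k..<n}) = card {1..k} + card {n - k..<n}"
    by (rule card_Un_disjoint) (use d assms(1) in \<open>auto split: if_splits\<close>)
  finally have cardD: "card D = d" using d assms(1) by (auto simp: M_def)
  have D_bounds: "0 < t" "t < n" if "t \<in> D" for t
    using that d assms(1) mid by (auto simp: D_def M_def split: if_splits)
  \<comment> \<open>The connection set is closed under negation, so an edge generated at one
    endpoint is also a shift of the other endpoint.\<close>
  have D_sym: "n - t \<in> D" if t: "t \<in> D" for t
  proof -
    have "k < n" using d assms(1) by linarith
    from t consider "t \<in> {1..k}" | "t \<in> {n - k..<n}" | "t \<in> M" by (auto simp: D_def)
    then show ?thesis
    proof cases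
      case 3
      then have "n - t = t" using mid(3) by (auto simp: M_def split: if_splits)
      then show ?thesis using t by simp
    qed (use \<open>k < n\<close> in \<open>auto simp: D_def\<close>)
  qed
  have shift_bounds: "shift u t < n" "shift u t \<noteq> u" if "u < n" "t \<in> D" for u t
    using that D_bounds[of t] by (auto simp: shift_def)
  have shift_inv: "shift (shift u t) (n - t) = u" if "u < n" "t \<in> D" for u t
    using that D_bounds[of t] by (auto simp: shift_def)
  have "E \<subseteq> all_pairs n"
    using shift_bounds by (fastforce simp: E_def)
  moreover have "card {u. {v, u} \<in> E} = d" if v: "v < n" for v
  proof -
    have "{u. {v, u} \<in> E} = shift v ` D"
    proof (intro equalityI subsetI)
      fix u assume "u \<in> {u. {v, u} \<in> E}"
      then obtain a t where a: "{v, u} = {a, shift a t}" "a < n" "t \<in> D" by (auto simp: E_def)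
      then consider "v = a" "u = shift a t" | "u = a" "v = shift a t" by (auto simp: doubleton_eq_iff)
      then show "u \<in> shift v ` D"
      proof cases
        case 2
        then have "u = shift v (n - t)" using shift_inv a by simp
        then show ?thesis using D_sym a by blast
      qed (use a in auto)
    qed (use v in \<open>auto simp: E_def\<close>)
    moreover have "inj_on (shift v) D"
    proof (rule inj_onI)
      fix s t assume "s \<in> D" "t \<in> D" "shift v s = shift v t"
      then show "s = t" using v D_bounds(2)[of s] D_bounds(2)[of t] by (auto simp: shift_def split: if_splits)
    qed
    ultimately show ?thesis using cardD by (simp add: card_image)
  qed
  ultimately have "E \<in> regular_graphs n d" by (simp add: regular_graphs_def)
  then show ?thesis by blast
qed

section \<open>Upper bound\<close>

text \<open>Equivalently, \<open>w\<close> lies on no triangle and no 4-cycle.\<close>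

definition locally_sparse :: "nat set set \<Rightarrow> nat \<Rightarrow> bool" where
  "locally_sparse E w \<longleftrightarrow> (\<forall>v v'. {w, v} \<in> E \<longrightarrow> {w, v'} \<in> E \<longrightarrow> v \<noteq> v' \<longrightarrow>
    {v, v'} \<notin> E \<and> (\<forall>z. {v, z} \<in> E \<longrightarrow> {v', z} \<in> E \<longrightarrow> z = w))"

text \<open>Such a neighbour \<open>v\<close> is able to force \<open>w\<close> as long as
  \<open>w\<close> is white and all white vertices lie in \<open>W\<close>.\<close>

definition has_private_nbr :: "nat set set \<Rightarrow> nat set \<Rightarrow> nat \<Rightarrow> bool" where
  "has_private_nbr E W w \<longleftrightarrow> (\<exists>v. {w, v} \<in> E \<and> v \<notin> W \<and> (\<forall>u\<in>W. {v, u} \<in> E \<longrightarrow> u = w))"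

text \<open>Privacy refers to the whole of \<open>W\<close>, so it survives while the white set
  \<open>U\<close> shrinks and any forcing order works. In the induction the vertex inserted last is
  forced first.\<close>

lemma zero_forcing_of_private_nbrs:
  assumes regular: "E \<in> regular_graphs n d" and "U \<subseteq> {0..<n}" "U \<subseteq> W" "\<And>w. w \<in> U \<Longrightarrow> has_private_nbr E W w"
  shows "zero_forcing_set n E ({0..<n} - U)"
proof -
  note edge_bounds = edge_bounds[OF regular]
  have "finite U" using assms(2) by (rule finite_subset) simp
  then have "(force_step n E)\<^sup>*\<^sup>* ({0..<n} - U) {0..<n}"
    using assms(2-)
  proof (induction U rule: finite_induct)
    case (insert w U)
    obtain v where v: "{w, v} \<in> E" "v \<notin> W" "\<forall>u\<in>W. {v, u} \<in> E \<longrightarrow> u = w"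
      using insert.prems(3)[of w] unfolding has_private_nbr_def by auto
    have "force_step n E ({0..<n} - insert w U) ({0..<n} - U)"
      unfolding force_step_def
    proof (intro exI conjI allI impI)
      show "v \<in> {0..<n} - insert w U" using v(1,2) edge_bounds(2)[OF v(1)] insert.prems(2) by auto
      show "w < n" "w \<notin> {0..<n} - insert w U" using insert.prems by auto
      show "{v, w} \<in> E" using v(1) by (simp add: insert_commute)
      show "u = w" if u: "{v, u} \<in> E \<and> u \<notin> {0..<n} - insert w U" for u
      proof -
        have "u < n" using u edge_bounds(2) by blast
        then have "u \<in> W" using u insert.prems(2) by auto
        then show ?thesis using u v(3) by blast
      qed
      show "{0..<n} - U = insert w ({0..<n} - insert w U)" using insert by auto
    qed
    moreover have "(force_step n E)\<^sup>*\<^sup>* ({0..<n} - U) {0..<n}"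
      using insert.prems by (intro insert.IH) auto
    ultimately show ?case by (rule converse_rtranclp_into_rtranclp)
  qed simp
  then show ?thesis by (simp add: zero_forcing_set_def)
qed

text \<open>The block \<open>B v\<close> consists of \<open>v\<close> and its neighbours other than
  \<open>w\<close>, which makes \<open>d\<close> vertices. If \<open>w\<close> is chosen but has no
  private neighbour, then every block meets \<open>W\<close>. Local sparsity makes the blocks
  disjoint and none contains \<open>w\<close>, so all these events are independent.\<close>

lemma private_nbr_expectation:
  assumes regular: "E \<in> regular_graphs n d" and w: "w < n" "locally_sparse E w" and p: "0 \<le> p" "p \<le> 1"
  shows "p * (1 - (1 - (1 - p) ^ d) ^ d)
    \<le> subset_expectation p {0..<n} (\<lambda>W. of_bool (w \<in> W \<and> has_private_nbr E W w))"
proof -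
  note [simp] = finite_regular_graph[OF regular]
  note edge_bounds = edge_bounds[OF regular] and card_nbrs = card_nbrs[OF regular]
  define N B where "N = {v. {w, v} \<in> E}" and "B = (\<lambda>v. insert v ({u. {v, u} \<in> E} - {w}))"
  let ?U = "\<Union>v\<in>N. B v"
  have N: "finite N" "card N = d" using card_nbrs[OF w(1)] by (simp_all add: N_def)
  have finB: "finite (B v)" for v by (simp add: B_def)
  have cardB: "card (B v) = d" if "v \<in> N" for v
  proof -
    have wv: "{w, v} \<in> E" using that by (simp add: N_def)
    then have "w \<in> {u. {v, u} \<in> E}" by (simp add: insert_commute)
    then have "card ({u. {v, u} \<in> E} - {w}) = d - 1" "0 < d"
      using card_nbrs[OF edge_bounds(2)[OF wv]] card_gt_0_iff[of "{u. {v, u} \<in> E}"] by auto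
    then show ?thesis unfolding B_def using edge_bounds(3)[of v v] by (subst card_insert_disjoint) auto
  qed
  have disj: "B v \<inter> B v' = {}" if "v \<in> N" "v' \<in> N" "v \<noteq> v'" for v v'
  proof -
    have *: "{v, v'} \<notin> E" "\<And>z. {v, z} \<in> E \<Longrightarrow> {v', z} \<in> E \<Longrightarrow> z = w"
      using w(2) that unfolding locally_sparse_def N_def by blast+
    moreover have "{v', v} \<notin> E" using *(1) by (simp add: insert_commute)
    ultimately show ?thesis unfolding B_def using that(3) by blast
  qed
  have wU: "w \<notin> ?U" unfolding B_def N_def using edge_bounds(3)[of w w] by auto
  have UV: "{w} \<union> ?U \<subseteq> {0..<n}"
    using w(1) edge_bounds unfolding B_def N_def by auto
  have finU: "finite ?U" using N finB by auto
  \<comment> \<open>The failure event is subtracted from the event that \<open>w\<close> is chosen.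
    Both are written through the trace of \<open>W\<close> on a small vertex set, ready for
    restricting the expectation to that set.\<close>
  have "subset_expectation p {0..<n} (\<lambda>W. of_bool (w \<in> W \<and> has_private_nbr E W w))
      \<ge> subset_expectation p {0..<n} (\<lambda>W. of_bool (w \<in> W \<inter> {w})
          - of_bool (w \<in> W \<inter> ({w} \<union> ?U) \<and> (\<forall>v\<in>N. W \<inter> ({w} \<union> ?U) \<inter> B v \<noteq> {})))"
  proof (rule subset_expectation_mono[OF p])
    fix W
    have "has_private_nbr E W w" if "w \<in> W" and nohit: "\<not> (\<forall>v\<in>N. W \<inter> ({w} \<union> ?U) \<inter> B v \<noteq> {})"
    proof -
      obtain v where v: "v \<in> N" "W \<inter> ({w} \<union> ?U) \<inter> B v = {}" using nohit by blast
      then have "W \<inter> B v = {}" by auto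
      then have "v \<notin> W" "\<forall>u\<in>W. {v, u} \<in> E \<longrightarrow> u = w" unfolding B_def by auto
      then show ?thesis using v(1) unfolding has_private_nbr_def N_def by blast
    qed
    then show "of_bool (w \<in> W \<inter> {w})
          - of_bool (w \<in> W \<inter> ({w} \<union> ?U) \<and> (\<forall>v\<in>N. W \<inter> ({w} \<union> ?U) \<inter> B v \<noteq> {}))
        \<le> (of_bool (w \<in> W \<and> has_private_nbr E W w) :: real)"
      by (auto simp del: UN_simps)
  qed
  moreover have "subset_expectation p {0..<n} (\<lambda>W. of_bool (w \<in> W \<inter> {w})) = p"
    using w(1) by (subst subset_expectation_restrict) (auto simp: subset_expectation_insert)
  moreover have "subset_expectation p {0..<n}
      (\<lambda>W. of_bool (w \<in> W \<inter> ({w} \<union> ?U) \<and> (\<forall>v\<in>N. W \<inter> ({w} \<union> ?U) \<inter> B v \<noteq> {})))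
      = p * (1 - (1 - p) ^ d) ^ d"
  proof -
    have "subset_expectation p {0..<n}
        (\<lambda>W. of_bool (w \<in> W \<inter> ({w} \<union> ?U) \<and> (\<forall>v\<in>N. W \<inter> ({w} \<union> ?U) \<inter> B v \<noteq> {})))
      = subset_expectation p ({w} \<union> ?U) (\<lambda>W. of_bool (w \<in> W \<and> (\<forall>v\<in>N. W \<inter> B v \<noteq> {})))"
      by (rule subset_expectation_restrict[OF _ UV]) simp
    also have "\<dots> = subset_expectation p ({w} \<union> ?U)
        (\<lambda>W. (\<lambda>X. of_bool (w \<in> X)) (W \<inter> {w}) * (\<lambda>X. of_bool (\<forall>v\<in>N. X \<inter> B v \<noteq> {})) (W \<inter> ?U))"
    proof (rule subset_expectation_cong)
      fix W
      have "W \<inter> ?U \<inter> B v = W \<inter> B v" if "v \<in> N" for v using that by auto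
      then show "of_bool (w \<in> W \<and> (\<forall>v\<in>N. W \<inter> B v \<noteq> {}))
        = (\<lambda>X. of_bool (w \<in> X) :: real) (W \<inter> {w}) * (\<lambda>X. of_bool (\<forall>v\<in>N. X \<inter> B v \<noteq> {})) (W \<inter> ?U)"
        by auto
    qed
    also have "\<dots> = subset_expectation p {w} (\<lambda>X. of_bool (w \<in> X))
        * subset_expectation p ?U (\<lambda>X. of_bool (\<forall>v\<in>N. X \<inter> B v \<noteq> {}))"
      using finU wU by (intro subset_expectation_indep) auto
    also have "subset_expectation p ?U (\<lambda>X. of_bool (\<forall>v\<in>N. X \<inter> B v \<noteq> {})) = (\<Prod>v\<in>N. 1 - (1 - p) ^ card (B v))"
      using N finB disj by (intro subset_expectation_hits_all)
    also have "\<dots> = (1 - (1 - p) ^ d) ^ d" using cardB N by simp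
    finally show ?thesis by (simp add: subset_expectation_insert)
  qed
  ultimately show ?thesis by (simp add: subset_expectation_diff algebra_simps)
qed

text \<open>Summing over the locally sparse vertices, some \<open>W\<close> has at least the
  expected number of members with a private neighbour; these members form the white set. The failure
  probability is simplified by \<open>1 - y \<le> exp (- y)\<close>.\<close>

lemma zero_forcing_number_le:
  fixes p :: real
  assumes regular: "E \<in> regular_graphs n d" and p: "0 \<le> p" "p \<le> 1"
  shows "real (zero_forcing_number n E)
    \<le> n - card {w \<in> {0..<n}. locally_sparse E w} * (p * (1 - exp (- (d * (1 - p) ^ d))))"
proof -
  note zero_forcing_of_private_nbrs = zero_forcing_of_private_nbrs[OF regular]
    and private_nbr_expectation = private_nbr_expectation[OF regular]
  let ?G = "{w \<in> {0..<n}. locally_sparse E w}"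
  let ?U = "\<lambda>W. {w \<in> {0..<n}. w \<in> W \<and> has_private_nbr E W w}"
  have "(1 - (1 - p) ^ d) ^ d \<le> exp (- ((1 - p) ^ d)) ^ d"
  proof (rule power_mono)
    show "1 - (1 - p) ^ d \<le> exp (- ((1 - p) ^ d))"
      using exp_ge_add_one_self[of "- ((1 - p) ^ d)"] by simp
    show "0 \<le> 1 - (1 - p) ^ d" using p by (simp add: power_le_one)
  qed
  also have "\<dots> = exp (- (d * (1 - p) ^ d))" by (simp flip: exp_of_nat_mult)
  finally have le: "(1 - (1 - p) ^ d) ^ d \<le> exp (- (d * (1 - p) ^ d))" .
  have "card ?G * (p * (1 - exp (- (d * (1 - p) ^ d)))) = (\<Sum>w\<in>?G. p * (1 - exp (- (d * (1 - p) ^ d))))"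
    by simp
  also have "\<dots> \<le> (\<Sum>w\<in>?G. subset_expectation p {0..<n} (\<lambda>W. of_bool (w \<in> W \<and> has_private_nbr E W w)))"
  proof (rule sum_mono)
    fix w assume "w \<in> ?G"
    then have "p * (1 - (1 - (1 - p) ^ d) ^ d)
        \<le> subset_expectation p {0..<n} (\<lambda>W. of_bool (w \<in> W \<and> has_private_nbr E W w))"
      using p by (intro private_nbr_expectation) auto
    moreover have "p * (1 - exp (- (d * (1 - p) ^ d))) \<le> p * (1 - (1 - (1 - p) ^ d) ^ d)"
      using p le by (intro mult_left_mono) auto
    ultimately show "p * (1 - exp (- (d * (1 - p) ^ d)))
        \<le> subset_expectation p {0..<n} (\<lambda>W. of_bool (w \<in> W \<and> has_private_nbr E W w))" by linarith
  qed
  also have "\<dots> = subset_expectation p {0..<n} (\<lambda>W. \<Sum>w\<in>?G. of_bool (w \<in> W \<and> has_private_nbr E W w))"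
    by (rule subset_expectation_sum[symmetric])
  also have "\<dots> \<le> subset_expectation p {0..<n} (\<lambda>W. real (card (?U W)))"
  proof (rule subset_expectation_mono[OF p])
    fix W
    have "(\<Sum>w\<in>?G. of_bool (w \<in> W \<and> has_private_nbr E W w) :: real)
        = card {w \<in> ?G. w \<in> W \<and> has_private_nbr E W w}"
      by (simp add: Int_def)
    also have "\<dots> \<le> card (?U W)" by (simp add: card_mono subset_eq)
    finally show "(\<Sum>w\<in>?G. of_bool (w \<in> W \<and> has_private_nbr E W w)) \<le> real (card (?U W))" by simp
  qed
  finally have *: "card ?G * (p * (1 - exp (- (d * (1 - p) ^ d))))
      \<le> subset_expectation p {0..<n} (\<lambda>W. real (card (?U W)))" .
  obtain W where "subset_expectation p {0..<n} (\<lambda>W. real (card (?U W))) \<le> real (card (?U W))"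
    using subset_expectation_attained[OF p, of "{0..<n}" "\<lambda>W. real (card (?U W))"] by auto
  with * have W: "card ?G * (p * (1 - exp (- (d * (1 - p) ^ d)))) \<le> real (card (?U W))" by linarith
  have "zero_forcing_set n E ({0..<n} - ?U W)"
    by (rule zero_forcing_of_private_nbrs[of _ W]) auto
  then have "zero_forcing_number n E \<le> card ({0..<n} - ?U W)"
    unfolding zero_forcing_number_def by (intro Least_le) auto
  also have "card ({0..<n} - ?U W) = n - card (?U W)" by (subst card_Diff_subset) auto
  finally have "zero_forcing_number n E \<le> n - card (?U W)" .
  moreover have "card (?U W) \<le> card {0..<n}" by (rule card_mono) auto
  ultimately show ?thesis using W by simp
qed

text \<open>Linearity of expectation, with the sum over all graphs left unnormalised. The number of
  candidate copies, at most \<open>n ^ k\<close>, cancels the denominator of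
  \<open>(2 * d / n) ^ k\<close>; this suits cycles, which have as many vertices as edges.\<close>

lemma expected_copies:
  fixes F :: "'t \<Rightarrow> nat set set"
  assumes T: "finite T" "card T \<le> n ^ k"
    and F: "\<And>t. t \<in> T \<Longrightarrow> finite (F t) \<and> card (F t) = k \<and> F t \<subseteq> all_pairs n"
    and n: "4 * (d + 1) + 4 * k \<le> n"
  shows "(\<Sum>E\<in>regular_graphs n d. real (card {t \<in> T. F t \<subseteq> E})) \<le> (2 * d) ^ k * card (regular_graphs n d)"
proof -
  let ?R = "regular_graphs n d"
  have npos: "0 < n" using n by simp
  have "(\<Sum>E\<in>?R. real (card {t \<in> T. F t \<subseteq> E})) = (\<Sum>E\<in>?R. \<Sum>t\<in>T. of_bool (F t \<subseteq> E))"
    using T(1) by (simp add: Int_def)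
  also have "\<dots> = (\<Sum>t\<in>T. \<Sum>E\<in>?R. of_bool (F t \<subseteq> E))" by (rule sum.swap)
  also have "\<dots> = (\<Sum>t\<in>T. real (card {E \<in> ?R. F t \<subseteq> E}))"
    using finite_regular_graphs by (simp add: Int_def)
  also have "\<dots> \<le> (\<Sum>t\<in>T. (2 * d / n) ^ k * card ?R)"
  proof (rule sum_mono)
    fix t assume "t \<in> T"
    then show "real (card {E \<in> ?R. F t \<subseteq> E}) \<le> (2 * d / n) ^ k * card ?R"
      using card_graphs_containing[of "F t" k n d] F n by auto
  qed
  also have "\<dots> = card T * ((2 * d / n) ^ k * card ?R)" by simp
  also have "\<dots> \<le> real (n ^ k) * ((2 * d / n) ^ k * card ?R)"
    using T(2) by (intro mult_right_mono) (simp_all only: of_nat_le_iff, simp)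
  also have "\<dots> = (2 * d) ^ k * card ?R" using npos by (simp add: power_divide)
  finally show ?thesis .
qed

text \<open>A vertex that is not locally sparse is the first entry of a labelled triangle
  (\<open>T3\<close>, \<open>F3\<close>) or a labelled 4-cycle (\<open>T4\<close>,
  \<open>F4\<close>) in the graph.\<close>

lemma expected_not_locally_sparse:
  assumes n: "4 * (d + 1) + 16 \<le> n"
  shows "(\<Sum>E\<in>regular_graphs n d. real (card {w \<in> {0..<n}. \<not> locally_sparse E w}))
    \<le> ((2 * d) ^ 3 + (2 * d) ^ 4) * card (regular_graphs n d)"
proof -
  let ?R = "regular_graphs n d"
  define T3 where "T3 = {(w, v, v'). w < n \<and> v < n \<and> v' < n \<and> w \<noteq> v \<and> w \<noteq> v' \<and> v \<noteq> v'}"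
  define T4 where "T4 = {(w, v, v', z). w < n \<and> v < n \<and> v' < n \<and> z < n \<and>
    w \<noteq> v \<and> w \<noteq> v' \<and> v \<noteq> v' \<and> z \<noteq> w \<and> z \<noteq> v \<and> z \<noteq> v'}"
  define F3 where "F3 = (\<lambda>(w::nat, v, v'). {{w, v}, {w, v'}, {v, v'}})"
  define F4 where "F4 = (\<lambda>(w::nat, v, v', z). {{w, v}, {w, v'}, {v, z}, {v', z}})"
  let ?V = "{0..<n}"
  have sub3: "T3 \<subseteq> ?V \<times> ?V \<times> ?V" by (auto simp: T3_def)
  have sub4: "T4 \<subseteq> ?V \<times> ?V \<times> ?V \<times> ?V" by (auto simp: T4_def)
  have T3: "finite T3" "card T3 \<le> n ^ 3"
    using finite_subset[OF sub3] card_mono[OF _ sub3] by (simp_all add: card_cartesian_product power3_eq_cube)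
  have T4: "finite T4" "card T4 \<le> n ^ 4"
    using finite_subset[OF sub4] card_mono[OF _ sub4] by (simp_all add: card_cartesian_product power4_eq_xxxx mult.assoc)
  have "card {w \<in> ?V. \<not> locally_sparse E w} \<le> card {t \<in> T3. F3 t \<subseteq> E} + card {t \<in> T4. F4 t \<subseteq> E}"
    if "E \<in> ?R" for E
  proof -
    have regular: "E \<in> regular_graphs n d" using that by simp
    note edge_bounds = edge_bounds[OF regular]
    have "{w \<in> ?V. \<not> locally_sparse E w} \<subseteq> fst ` {t \<in> T3. F3 t \<subseteq> E} \<union> fst ` {t \<in> T4. F4 t \<subseteq> E}"
    proof
      fix w assume "w \<in> {w \<in> ?V. \<not> locally_sparse E w}"
      then obtain v v' where v: "{w, v} \<in> E" "{w, v'} \<in> E" "v \<noteq> v'"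
        and c: "{v, v'} \<in> E \<or> (\<exists>z. {v, z} \<in> E \<and> {v', z} \<in> E \<and> z \<noteq> w)"
        unfolding locally_sparse_def by blast
      note b = edge_bounds[OF v(1)] edge_bounds[OF v(2)]
      from c show "w \<in> fst ` {t \<in> T3. F3 t \<subseteq> E} \<union> fst ` {t \<in> T4. F4 t \<subseteq> E}"
      proof
        assume "{v, v'} \<in> E"
        then have "(w, v, v') \<in> {t \<in> T3. F3 t \<subseteq> E}" using v b by (simp add: T3_def F3_def)
        then show ?thesis by force
      next
        assume "\<exists>z. {v, z} \<in> E \<and> {v', z} \<in> E \<and> z \<noteq> w"
        then obtain z where z: "{v, z} \<in> E" "{v', z} \<in> E" "z \<noteq> w" by blast
        have "(w, v, v', z) \<in> {t \<in> T4. F4 t \<subseteq> E}"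
          using v b z edge_bounds[OF z(1)] edge_bounds[OF z(2)] by (simp add: T4_def F4_def)
        then show ?thesis by force
      qed
    qed
    then have "card {w \<in> ?V. \<not> locally_sparse E w} \<le> card (fst ` {t \<in> T3. F3 t \<subseteq> E} \<union> fst ` {t \<in> T4. F4 t \<subseteq> E})"
      using T3 T4 by (intro card_mono) auto
    also have "\<dots> \<le> card (fst ` {t \<in> T3. F3 t \<subseteq> E}) + card (fst ` {t \<in> T4. F4 t \<subseteq> E})"
      by (rule card_Un_le)
    also have "\<dots> \<le> card {t \<in> T3. F3 t \<subseteq> E} + card {t \<in> T4. F4 t \<subseteq> E}"
      using T3 T4 by (intro add_mono card_image_le) auto
    finally show ?thesis .
  qed
  then have "(\<Sum>E\<in>?R. real (card {w \<in> ?V. \<not> locally_sparse E w}))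
      \<le> (\<Sum>E\<in>?R. real (card {t \<in> T3. F3 t \<subseteq> E}) + real (card {t \<in> T4. F4 t \<subseteq> E}))"
    by (intro sum_mono) (simp only: of_nat_le_iff flip: of_nat_add)
  also have "\<dots> = (\<Sum>E\<in>?R. real (card {t \<in> T3. F3 t \<subseteq> E})) + (\<Sum>E\<in>?R. real (card {t \<in> T4. F4 t \<subseteq> E}))"
    by (rule sum.distrib)
  also have "\<dots> \<le> (2 * d) ^ 3 * card ?R + (2 * d) ^ 4 * card ?R"
  proof -
    have "(\<Sum>E\<in>?R. real (card {t \<in> T3. F3 t \<subseteq> E})) \<le> (2 * d) ^ 3 * card ?R"
    proof (rule expected_copies[OF T3])
      fix t assume t: "t \<in> T3"
      obtain w v v' where "t = (w, v, v')" by (metis prod.exhaust)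
      with t show "finite (F3 t) \<and> card (F3 t) = 3 \<and> F3 t \<subseteq> all_pairs n"
        by (simp add: T3_def F3_def doubleton_eq_iff card_insert_if)
    qed (use n in simp)
    moreover have "(\<Sum>E\<in>?R. real (card {t \<in> T4. F4 t \<subseteq> E})) \<le> (2 * d) ^ 4 * card ?R"
    proof (rule expected_copies[OF T4])
      fix t assume t: "t \<in> T4"
      obtain w v v' z where "t = (w, v, v', z)" by (metis prod.exhaust)
      with t show "finite (F4 t) \<and> card (F4 t) = 4 \<and> F4 t \<subseteq> all_pairs n"
        by (simp add: T4_def F4_def doubleton_eq_iff card_insert_if)
    qed (use n in simp)
    ultimately show ?thesis by simp
  qed
  finally show ?thesis by (simp add: algebra_simps)
qed

text \<open>The probability \<open>p = ln d / (2 * d)\<close> gives nearly every locally sparse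
  vertex of \<open>W\<close> a private neighbour once \<open>d\<close> is large. The failure
  estimate is a bound on counts, so it makes sense even for \<open>n\<close> without any
  \<open>d\<close>-regular graph.\<close>

lemma zero_forcing_number_upper_bound:
  fixes \<epsilon> :: real
  assumes "0 < \<epsilon>" "\<epsilon> \<le> 1"
  shows "\<exists>d0. \<forall>d\<ge>d0. \<exists>g :: nat \<Rightarrow> real. g \<longlonglongrightarrow> 0 \<and> (\<forall>\<^sub>F n in sequentially.
    real (card {E \<in> regular_graphs n d.
      \<not> real (zero_forcing_number n E) \<le> real n * (1 - (1 - \<epsilon>) * (ln (real d) / (2 * real d)))})
    \<le> g n * card (regular_graphs n d))"
proof -
  have "\<forall>\<^sub>F d :: nat in sequentially. 1 / 2 * (ln (real d) / d) < 1 \<and>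
    exp (- (real d * (1 - ln (real d) / (2 * real d)) powr real d)) < \<epsilon> / 2 \<and> 1 < d"
    using assms
    by (intro eventually_conj eventually_ln_over_less eventually_exp_neg_power_less eventually_gt_at_top) simp_all
  then have "\<forall>\<^sub>F d :: nat in sequentially. 0 < ln (real d) \<and> ln (real d) / (2 * real d) < 1 \<and>
    exp (- (real d * (1 - ln (real d) / (2 * real d)) powr real d)) < \<epsilon> / 2 \<and> 1 < real d"
    by eventually_elim simp
  then obtain d0 where d0: "\<And>d. d \<ge> d0 \<Longrightarrow> 0 < ln (real d)" "\<And>d. d \<ge> d0 \<Longrightarrow> ln (real d) / (2 * real d) < 1"
    "\<And>d. d \<ge> d0 \<Longrightarrow> exp (- (real d * (1 - ln (real d) / (2 * real d)) powr real d)) < \<epsilon> / 2"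
    "\<And>d. d \<ge> d0 \<Longrightarrow> 1 < real d"
    unfolding eventually_sequentially by blast
  show ?thesis
  proof (intro exI[of _ d0] allI impI)
    fix d assume d: "d0 \<le> d"
    define p where "p = ln (real d) / (2 * real d)"
    have p: "0 < p" "p < 1" using d0[OF d] by (auto simp: p_def)
    have q: "exp (- (d * (1 - p) ^ d)) < \<epsilon> / 2"
      using d0(3)[OF d] p by (simp add: powr_realpow flip: p_def)
    define g where "g = (\<lambda>n::nat. ((2 * real d) ^ 3 + (2 * real d) ^ 4) / (\<epsilon> / 2 * n))"
    have "g \<longlonglongrightarrow> 0" unfolding g_def using assms by (intro const_over_linear_tendsto_0) simp
    moreover have "\<forall>\<^sub>F n in sequentially. real (card {E \<in> regular_graphs n d.
        \<not> real (zero_forcing_number n E) \<le> real n * (1 - (1 - \<epsilon>) * p)}) \<le> g n * card (regular_graphs n d)"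
      using eventually_ge_at_top[of "4 * (d + 1) + 16"]
    proof eventually_elim
      case (elim n)
      let ?R = "regular_graphs n d"
      let ?bad = "\<lambda>E. {w \<in> {0..<n}. \<not> locally_sparse E w}"
      let ?B = "{E \<in> ?R. \<not> real (zero_forcing_number n E) \<le> real n * (1 - (1 - \<epsilon>) * p)}"
      have n: "0 < real n" using elim by simp
      have many: "\<epsilon> / 2 * n \<le> real (card (?bad E))" if "E \<in> ?B" for E
      proof (rule ccontr)
        assume few: "\<not> \<epsilon> / 2 * n \<le> real (card (?bad E))"
        have regular: "E \<in> regular_graphs n d" using that by simp
        note zero_forcing_number_le = zero_forcing_number_le[OF regular]
        let ?G = "{w \<in> {0..<n}. locally_sparse E w}"
        have "card {0..<n} = card (?G \<union> ?bad E)" by (intro arg_cong[where f = card]) auto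
        also have "\<dots> = card ?G + card (?bad E)" by (rule card_Un_disjoint) auto
        finally have "real n = real (card ?G) + real (card (?bad E))" by simp
        then have G: "(1 - \<epsilon> / 2) * n \<le> real (card ?G)" using few by (simp add: algebra_simps)
        \<comment> \<open>One factor \<open>1 -\<close> \<epsilon> \<open>/ 2\<close> pays for the
          vertices on short cycles, the other for the vertices of \<open>W\<close> without a private
          neighbour.\<close>
        have "(1 - \<epsilon>) * p * n \<le> ((1 - \<epsilon> / 2) * (1 - \<epsilon> / 2)) * (p * n)"
        proof -
          have "1 - \<epsilon> \<le> (1 - \<epsilon> / 2) * (1 - \<epsilon> / 2)" by (simp add: algebra_simps)
          then have "(1 - \<epsilon>) * (p * n) \<le> ((1 - \<epsilon> / 2) * (1 - \<epsilon> / 2)) * (p * n)"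
            using p n by (intro mult_right_mono) auto
          then show ?thesis by (simp only: mult.assoc)
        qed
        also have "\<dots> = (1 - \<epsilon> / 2) * n * (p * (1 - \<epsilon> / 2))" by (simp only: mult_ac)
        also have "\<dots> \<le> card ?G * (p * (1 - exp (- (d * (1 - p) ^ d))))"
          using G q p assms by (intro mult_mono) auto
        also have "\<dots> \<le> n - real (zero_forcing_number n E)"
          using zero_forcing_number_le[of p] p by simp
        finally have "real (zero_forcing_number n E) \<le> real n * (1 - (1 - \<epsilon>) * p)"
          by (simp add: algebra_simps)
        then show False using that by simp
      qed
      \<comment> \<open>Markov's inequality for the number of vertices that are not locally
        sparse.\<close>
      have "card ?B * (\<epsilon> / 2 * n) = (\<Sum>E\<in>?B. \<epsilon> / 2 * n)" by simp
      also have "\<dots> \<le> (\<Sum>E\<in>?B. real (card (?bad E)))" by (intro sum_mono many)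
      also have "\<dots> \<le> (\<Sum>E\<in>?R. real (card (?bad E)))"
        using finite_regular_graphs by (intro sum_mono2) auto
      also have "\<dots> \<le> ((2 * d) ^ 3 + (2 * d) ^ 4) * card ?R"
        using elim by (intro expected_not_locally_sparse) auto
      finally show ?case using n assms by (simp add: g_def field_simps)
    qed
    ultimately show "\<exists>g :: nat \<Rightarrow> real. g \<longlonglongrightarrow> 0 \<and> (\<forall>\<^sub>F n in sequentially.
      real (card {E \<in> regular_graphs n d.
        \<not> real (zero_forcing_number n E) \<le> real n * (1 - (1 - \<epsilon>) * (ln (real d) / (2 * real d)))})
      \<le> g n * card (regular_graphs n d))" unfolding p_def by blast
  qed
qed

section \<open>Switchings that create a crossing edge\<close>

lemma card_arcs_leaving:
  assumes regular: "E \<in> regular_graphs n d" and "A \<subseteq> {0..<n}"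
  shows "real (card {(x, v). {x, v} \<in> E \<and> x \<in> A \<and> v \<notin> B}) = real (card A) * d - card (crossing A B E)"
proof -
  note [simp] = finite_regular_graph[OF regular]
  note card_nbrs = card_nbrs[OF regular] and finite_arcs = finite_regular_graph(3)[OF regular]
  have fA: "finite A" using assms(2) by (rule finite_subset) simp
  have "crossing A B E \<union> {(x, v). {x, v} \<in> E \<and> x \<in> A \<and> v \<notin> B} = Sigma A (\<lambda>x. {v. {x, v} \<in> E})"
    by (auto simp: crossing_def)
  moreover have "card (crossing A B E \<union> {(x, v). {x, v} \<in> E \<and> x \<in> A \<and> v \<notin> B})
      = card (crossing A B E) + card {(x, v). {x, v} \<in> E \<and> x \<in> A \<and> v \<notin> B}"
    by (rule card_Un_disjoint)
      (auto simp: crossing_def intro: finite_subset[OF _ finite_arcs])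
  moreover have "card (Sigma A (\<lambda>x. {v. {x, v} \<in> E})) = (\<Sum>x\<in>A. card {v. {x, v} \<in> E})"
    using fA by (intro card_SigmaI) auto
  moreover have "\<dots> = (\<Sum>x\<in>A. d)"
    using assms by (intro sum.cong card_nbrs) auto
  ultimately have "card A * d = card (crossing A B E) + card {(x, v). {x, v} \<in> E \<and> x \<in> A \<and> v \<notin> B}"
    by simp
  then have "real (card A * d) = real (card (crossing A B E) + card {(x, v). {x, v} \<in> E \<and> x \<in> A \<and> v \<notin> B})"
    by (simp only:)
  then show ?thesis by simp
qed

lemma card_crossing_commute: "card (crossing A B E) = card (crossing B A E)"
proof -
  have "crossing A B E = prod.swap ` crossing B A E"
    by (auto simp: crossing_def image_iff insert_commute)
  then show ?thesis by (simp add: card_image)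
qed

text \<open>The switching replaces edges \<open>xv\<close>, \<open>yu\<close>, \<open>pq\<close> by \<open>xy\<close>, \<open>vp\<close>, \<open>uq\<close>. The third edge \<open>pq\<close>, chosen
  away from \<open>A \<union> B\<close>, is what prevents a second crossing edge from appearing when \<open>v \<in> A\<close> and \<open>u \<in> B\<close>.\<close>

definition switch_sources ::
  "nat set \<Rightarrow> nat set \<Rightarrow> nat set set \<Rightarrow> (((nat \<times> nat) \<times> (nat \<times> nat)) \<times> (nat \<times> nat)) set" where
  "switch_sources A B E =
    Sigma ({(x, v). {x, v} \<in> E \<and> x \<in> A \<and> v \<notin> B} \<times> {(y, u). {y, u} \<in> E \<and> y \<in> B \<and> u \<notin> A}
        - {((x, v), (y, u)). {x, v} \<in> E \<and> {y, u} \<in> E \<and> (x, y) \<in> crossing A B E})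
      (\<lambda>((x, v), (y, u)). arcs E
        - {(p, q). {p, q} \<in> E \<and> p \<in> A \<union> B \<union> insert u (insert v {w. {v, w} \<in> E})}
        - {(p, q). {p, q} \<in> E \<and> q \<in> A \<union> B \<union> insert v (insert u {w. {u, w} \<in> E})})"

text \<open>A reverse switching is described by the crossing edge \<open>xy\<close> and the arcs
  \<open>vp\<close> and \<open>uq\<close>; an overcount suffices for the upper bound. The tuple is
  rearranged so that a step carries the same label in both directions.\<close>

definition switch_targets ::
  "nat set \<Rightarrow> nat set \<Rightarrow> nat set set \<Rightarrow> (((nat \<times> nat) \<times> (nat \<times> nat)) \<times> (nat \<times> nat)) set" where
  "switch_targets A B E =
    (\<lambda>((x, y), (v, p), (u, q)). (((x, v), (y, u)), (p, q))) ` (crossing A B E \<times> arcs E \<times> arcs E)"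

lemma finite_switch_targets:
  "E \<in> regular_graphs n d \<Longrightarrow> finite (switch_targets A B E)"
  by (simp add: switch_targets_def finite_regular_graph)

lemma card_switch_targets:
  assumes regular: "E \<in> regular_graphs n d"
  shows "card (switch_targets A B E) \<le> card (crossing A B E) * (n * d)\<^sup>2"
proof -
  note [simp] = finite_regular_graph[OF regular]
  note card_arcs = card_arcs[OF regular]
  have "card (switch_targets A B E) \<le> card (crossing A B E \<times> arcs E \<times> arcs E)"
    unfolding switch_targets_def by (rule card_image_le) simp
  then show ?thesis by (simp add: card_cartesian_product card_arcs power2_eq_square)
qed

text \<open>On each side \<open>s * d - j\<close> arcs leave towards vertices outside the other set.
  From the pairs of such arcs at most \<open>j * d\<^sup>2\<close> are discarded because
  \<open>xy\<close> is already an edge. For each remaining pair, either end of \<open>pq\<close>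
  avoids at most \<open>2 * s + d + 2\<close> vertices.\<close>

lemma card_switch_sources:
  assumes regular: "E \<in> regular_graphs n d"
    and A: "A \<subseteq> {0..<n}" "card A = s" and B: "B \<subseteq> {0..<n}" "card B = s"
    and j: "card (crossing A B E) = j"
    and q: "0 \<le> real n * d - 4 * s * d - 2 * (d + 2) * d"
  shows "finite (switch_sources A B E) \<and>
    ((real s * d - j)\<^sup>2 - real j * d\<^sup>2) * (real n * d - 4 * s * d - 2 * (d + 2) * d)
      \<le> real (card (switch_sources A B E))"
proof -
  note [simp] = finite_regular_graph[OF regular]
  note card_nbrs_le = card_nbrs_le[OF regular] and card_arcs = card_arcs[OF regular]
    and card_arcs_from_le = card_arcs_from_le[OF regular]
    and card_arcs_to_le = card_arcs_to_le[OF regular]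
    and card_closed_nbhd_le = card_closed_nbhd_le[OF regular]
    and card_arcs_leaving = card_arcs_leaving[OF regular]
    and finite_arcs = finite_regular_graph(3)[OF regular]
  let ?L1 = "{(x, v). {x, v} \<in> E \<and> x \<in> A \<and> v \<notin> B}"
  let ?L2 = "{(y, u). {y, u} \<in> E \<and> y \<in> B \<and> u \<notin> A}"
  let ?bad = "{((x, v), (y, u)). {x, v} \<in> E \<and> {y, u} \<in> E \<and> (x, y) \<in> crossing A B E}"
  let ?M = "?L1 \<times> ?L2 - ?bad"
  let ?X = "\<lambda>u v. A \<union> B \<union> insert u (insert v {w. {v, w} \<in> E})"
  let ?F = "\<lambda>u v. {(p, q). {p, q} \<in> E \<and> p \<in> ?X u v}"
  let ?T = "\<lambda>u v. {(p, q). {p, q} \<in> E \<and> q \<in> ?X v u}"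
  let ?Q = "\<lambda>((x, v), (y, u)). arcs E - ?F u v - ?T u v"
  have fAB: "finite A" "finite B" using A B by (auto intro: finite_subset)
  have fin: "finite ?L1" "finite ?L2" "finite (?F u v)" "finite (?T u v)" for u v
    by (rule finite_subset[OF _ finite_arcs], auto)+
  \<comment> \<open>A discarded pair is a crossing edge \<open>xy\<close> together with a neighbour
    \<open>v\<close> of \<open>x\<close> and a neighbour \<open>u\<close> of
    \<open>y\<close>.\<close>
  have bad_sub: "?bad \<subseteq> (\<lambda>((x, y), (v, u)). ((x, v), (y, u))) `
      Sigma (crossing A B E) (\<lambda>(x, y). {v. {x, v} \<in> E} \<times> {u. {y, u} \<in> E})" (is "_ \<subseteq> ?h ` ?S")
    by (force simp: image_iff)
  have fS: "finite ?S" by (rule finite_SigmaI) auto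
  have fbad: "finite ?bad" using bad_sub fS by (rule finite_subset[OF _ finite_imageI])
  have "card ?bad \<le> card (?h ` ?S)" using fS by (intro card_mono bad_sub) simp
  also have "\<dots> \<le> card ?S" by (rule card_image_le[OF fS])
  also have "\<dots> = (\<Sum>(x, y)\<in>crossing A B E. card ({v. {x, v} \<in> E} \<times> {u. {y, u} \<in> E}))"
    by (subst card_SigmaI) (auto simp: case_prod_beta)
  also have "\<dots> \<le> (\<Sum>(x, y)\<in>crossing A B E. d * d)"
    unfolding case_prod_beta card_cartesian_product
    by (intro sum_mono mult_mono card_nbrs_le) auto
  finally have "card ?bad \<le> j * d\<^sup>2" using j by (simp add: power2_eq_square)
  then have bad: "real (card ?bad) \<le> real j * d\<^sup>2" by (simp only: of_nat_le_iff flip: of_nat_mult of_nat_power)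
  have "real (card (?L1 \<times> ?L2)) = (real s * d - j) * (real s * d - j)"
    unfolding card_cartesian_product of_nat_mult
    using card_arcs_leaving[OF A(1), of B] card_arcs_leaving[OF B(1), of A] A(2) B(2) j
      card_crossing_commute[of A B E] by simp
  then have M: "(real s * d - j)\<^sup>2 - real j * d\<^sup>2 \<le> real (card ?M)"
    using card_Diff_ge[OF fbad, of "?L1 \<times> ?L2"] bad by (simp only: power2_eq_square)
  have cX: "card (?X u v) * d \<le> (2 * s + (d + 2)) * d" and fX: "finite (?X u v)" for u v
  proof -
    have "card (?X u v) \<le> card (A \<union> B) + card (insert u (insert v {w. {v, w} \<in> E}))"
      by (rule card_Un_le)
    also have "card (A \<union> B) \<le> s + s" using card_Un_le[of A B] A B by simp
    also have "card (insert u (insert v {w. {v, w} \<in> E})) \<le> Suc (card (insert v {w. {v, w} \<in> E}))"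
      by (rule card_insert_le_m1) auto
    also have "\<dots> \<le> d + 2" using card_closed_nbhd_le[of v] by simp
    finally show "card (?X u v) * d \<le> (2 * s + (d + 2)) * d"
      by (intro mult_right_mono) (auto simp: mult_2)
    show "finite (?X u v)" using fAB by simp
  qed
  have Q: "finite (?Q t) \<and> real n * d - 4 * s * d - 2 * (d + 2) * d \<le> real (card (?Q t))" for t
  proof -
    obtain x v y u where t: "t = ((x, v), (y, u))" by (metis prod.exhaust)
    have "card (?F u v) \<le> (2 * s + (d + 2)) * d" "card (?T u v) \<le> (2 * s + (d + 2)) * d"
      using card_arcs_from_le[OF fX[of u v]] card_arcs_to_le[OF fX[of v u]] cX[of u v] cX[of v u]
      by linarith+
    then have "real (card (?F u v)) \<le> (2 * s + (d + 2)) * d"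
      "real (card (?T u v)) \<le> (2 * s + (d + 2)) * d"
      by (simp_all only: of_nat_le_iff)
    moreover have "real (n * d) - card (?F u v) \<le> card (arcs E - ?F u v)"
      using card_Diff_ge[OF fin(3), of "arcs E"] card_arcs by simp
    moreover have "real (card (arcs E - ?F u v)) - card (?T u v) \<le> card (arcs E - ?F u v - ?T u v)"
      by (rule card_Diff_ge[OF fin(4)])
    ultimately have "real n * d - 4 * s * d - 2 * (d + 2) * d \<le> real (card (arcs E - ?F u v - ?T u v))"
      by (simp add: algebra_simps)
    then show ?thesis unfolding t prod.case by simp
  qed
  have fM: "finite ?M" using fin by simp
  have "((real s * d - j)\<^sup>2 - real j * d\<^sup>2) * (real n * d - 4 * s * d - 2 * (d + 2) * d)
      \<le> real (card ?M) * (real n * d - 4 * s * d - 2 * (d + 2) * d)"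
    using M q by (rule mult_right_mono)
  also have "\<dots> = (\<Sum>t\<in>?M. real n * d - 4 * s * d - 2 * (d + 2) * d)"
    by simp
  also have "\<dots> \<le> (\<Sum>t\<in>?M. real (card (?Q t)))"
    using Q by (intro sum_mono) blast
  also have "\<dots> = real (card (Sigma ?M ?Q))"
    using fM Q by (subst card_SigmaI) auto
  finally have "((real s * d - j)\<^sup>2 - real j * d\<^sup>2) * (real n * d - 4 * s * d - 2 * (d + 2) * d)
    \<le> real (card (Sigma ?M ?Q))" .
  moreover have "finite (Sigma ?M ?Q)" by (rule finite_SigmaI[OF fM]) (rule conjunct1[OF Q])
  ultimately show ?thesis unfolding switch_sources_def by blast
qed

text \<open>No removed edge crosses, since \<open>v\<close> is outside \<open>B\<close>,
  \<open>u\<close> is outside \<open>A\<close>, and \<open>p\<close>, \<open>q\<close> are outside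
  both. For the same \<open>p\<close> and \<open>q\<close> the new edges \<open>vp\<close> and
  \<open>uq\<close> do not cross either, so \<open>xy\<close> is the only change.\<close>

lemma switch_crossing:
  assumes regular: "E \<in> regular_graphs n d" and dis: "A \<inter> B = {}"
    and t: "(((x, v), (y, u)), (p, q)) \<in> switch_sources A B E"
  defines "R \<equiv> {{x, v}, {y, u}, {p, q}}" and "S \<equiv> {{x, y}, {v, p}, {u, q}}"
  shows "R \<subseteq> E" "S \<inter> E = {}" "E - R \<union> S \<in> regular_graphs n d"
    "crossing A B (E - R \<union> S) = insert (x, y) (crossing A B E)" "(x, y) \<notin> crossing A B E"
proof -
  note edge_bounds = edge_bounds[OF regular] and switch = switch[OF regular]
  have e: "{x, v} \<in> E" "{y, u} \<in> E" "{p, q} \<in> E"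
    and m: "x \<in> A" "v \<notin> B" "y \<in> B" "u \<notin> A"
      "p \<notin> A" "p \<notin> B" "p \<noteq> u" "p \<noteq> v" "q \<notin> A" "q \<notin> B" "q \<noteq> u" "q \<noteq> v"
    and ne: "{x, y} \<notin> E" "{v, p} \<notin> E" "{u, q} \<notin> E"
    using t by (auto simp: switch_sources_def crossing_def)
  have m2: "x \<notin> B" "y \<notin> A" "x \<noteq> y" "x \<noteq> u" "y \<noteq> v" "x \<noteq> p" "x \<noteq> q" "y \<noteq> p" "y \<noteq> q"
    using dis m by auto
  note b = edge_bounds[OF e(1)] edge_bounds[OF e(2)] edge_bounds[OF e(3)]
  show R: "R \<subseteq> E" and S: "S \<inter> E = {}" using e ne by (simp_all add: R_def S_def)
  show "E - R \<union> S \<in> regular_graphs n d"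
  proof (rule switch[OF R S])
    show "S \<subseteq> all_pairs n" using b m m2 by (simp add: S_def)
    show "(\<Sum>e\<in>R. of_bool (z \<in> e) :: nat) = (\<Sum>e\<in>S. of_bool (z \<in> e))" for z
      unfolding R_def S_def
      by (rule incidence_triple_switch) (use m m2 b in \<open>simp_all add: doubleton_eq_iff\<close>)
  qed
  show new: "(x, y) \<notin> crossing A B E" using ne by (simp add: crossing_def)
  have "{a, b} \<notin> R" if "a \<in> A" "b \<in> B" for a b
    using that m m2 unfolding R_def by (simp add: doubleton_eq_iff) blast
  moreover have "{a, b} \<in> S \<longleftrightarrow> a = x \<and> b = y" if "a \<in> A" "b \<in> B" for a b
    using that m m2 unfolding S_def by (simp add: doubleton_eq_iff) blast
  ultimately show "crossing A B (E - R \<union> S) = insert (x, y) (crossing A B E)"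
    using m unfolding crossing_def by blast
qed

text \<open>Double counting of these switchings. For \<open>s\<close> small against \<open>n\<close>
  the resulting ratio of consecutive counts is about \<open>(d * s\<^sup>2 / n) / (j + 1)\<close>,
  as for a Poisson variable of mean \<open>d * s\<^sup>2 / n\<close>.\<close>

lemma card_graphs_crossing_Suc:
  fixes n d s j :: nat and A B :: "nat set"
  assumes A: "A \<subseteq> {0..<n}" "card A = s" and B: "B \<subseteq> {0..<n}" "card B = s"
    and dis: "A \<inter> B = {}"
    and q: "0 \<le> real n * d - 4 * s * d - 2 * (d + 2) * d"
  shows "real (card {E \<in> regular_graphs n d. card (crossing A B E) = j})
      * (((real s * d - j)\<^sup>2 - real j * d\<^sup>2) * (real n * d - 4 * s * d - 2 * (d + 2) * d))
    \<le> real (card {E \<in> regular_graphs n d. card (crossing A B E) = Suc j}) * (Suc j * (n * d)\<^sup>2)"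
proof -
  let ?f = "\<lambda>E (((x, v), (y, u)), (p, q)). E - {{x, v}, {y, u}, {p, q}} \<union> {{x, y}, {v, p}, {u, q}}"
  let ?g = "\<lambda>E (((x, v), (y, u)), (p, q)). E - {{x, y}, {v, p}, {u, q}} \<union> {{x, v}, {y, u}, {p, q}}"
  show ?thesis
  proof (rule switching_double_count[where T = "switch_sources A B" and T' = "switch_targets A B"
        and f = ?f and g = ?g])
    show "finite {E \<in> regular_graphs n d. card (crossing A B E) = j}"
      "finite {E \<in> regular_graphs n d. card (crossing A B E) = Suc j}"
      using finite_regular_graphs by auto
  next
    fix E assume E: "E \<in> {E \<in> regular_graphs n d. card (crossing A B E) = Suc j}"
    then have regular: "E \<in> regular_graphs n d" by simp
    note [simp] = finite_regular_graph[OF regular]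
    note finite_switch_targets = finite_switch_targets[OF regular]
      and card_switch_targets = card_switch_targets[OF regular]
    show "finite (switch_targets A B E)" by (rule finite_switch_targets)
    show "real (card (switch_targets A B E)) \<le> real (Suc j * (n * d)\<^sup>2)"
      using card_switch_targets[of A B] E by (simp only: of_nat_le_iff mem_Collect_eq)
  next
    fix E assume E: "E \<in> {E \<in> regular_graphs n d. card (crossing A B E) = j}"
    then have regular: "E \<in> regular_graphs n d" by simp
    note [simp] = finite_regular_graph[OF regular]
    note card_switch_sources = card_switch_sources[OF regular]
      and switch_crossing = switch_crossing[OF regular]
    show "finite (switch_sources A B E) \<and>
      ((real s * d - j)\<^sup>2 - real j * d\<^sup>2) * (real n * d - 4 * s * d - 2 * (d + 2) * d)
        \<le> real (card (switch_sources A B E))"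
      using E by (intro card_switch_sources A B q) auto
    fix t assume t: "t \<in> switch_sources A B E"
    obtain x v y u p q where t_eq: "t = (((x, v), (y, u)), (p, q))" by (metis prod.exhaust)
    let ?R = "{{x, v}, {y, u}, {p, q}}" and ?S = "{{x, y}, {v, p}, {u, q}}"
    note sw = switch_crossing[OF dis t[unfolded t_eq]]
    have "card (crossing A B (E - ?R \<union> ?S)) = Suc j"
      unfolding sw(4) using sw(5) E by (subst card_insert_disjoint) auto
    moreover have "t \<in> switch_targets A B (E - ?R \<union> ?S)"
      unfolding switch_targets_def
    proof (rule image_eqI[of _ _ "((x, y), (v, p), (u, q))"])
      show "((x, y), (v, p), (u, q)) \<in> crossing A B (E - ?R \<union> ?S) \<times> arcs (E - ?R \<union> ?S) \<times> arcs (E - ?R \<union> ?S)"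
        unfolding sw(4) by simp
    qed (simp add: t_eq)
    ultimately show "?f E t \<in> {E \<in> regular_graphs n d. card (crossing A B E) = Suc j} \<and>
        t \<in> switch_targets A B (?f E t) \<and> ?g (?f E t) t = E"
      using sw(3) undo_switch[OF sw(1,2)] unfolding t_eq prod.case by blast
  qed
qed

section \<open>Lower bound\<close>

text \<open>The ratio of consecutive crossing counts is that of a Poisson variable of mean at least \<open>x\<close>;
  telescoping from \<open>0\<close> up to about \<open>x\<close> gives the Poisson probability \<open>exp (- x)\<close> of the value \<open>0\<close>.\<close>

lemma card_graphs_without_crossing:
  fixes n d s :: nat and A B :: "nat set" and \<eta> :: real
  assumes A: "A \<subseteq> {0..<n}" "card A = s" and B: "B \<subseteq> {0..<n}" "card B = s" and dis: "A \<inter> B = {}"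
    and pos: "n > 0" "d > 0"
    and \<eta>: "6 * (real s / n) + (3 * real d + 4) / n \<le> \<eta>" "0 \<le> \<eta>" "\<eta> \<le> 1"
    and x: "x = (1 - \<eta>) * (d * real s ^ 2 / n)" "1 \<le> x"
  shows "real (card {E \<in> regular_graphs n d. crossing A B E = {}})
    \<le> x * exp (2 - x) * card (regular_graphs n d)"
proof -
  let ?N = "\<lambda>j. real (card {E \<in> regular_graphs n d. card (crossing A B E) = j})"
  let ?\<mu> = "d * real s ^ 2 / n"
  have step: "?N j * x \<le> ?N (Suc j) * Suc j" if "real j \<le> ?\<mu>" for j
  proof -
    note r = switching_ratio_bound[of "real n" "real d" "real s" "real j" \<eta>]
    have q: "0 \<le> real n * d - 4 * s * d - 2 * (d + 2) * d"
      using r(2) that pos \<eta> by (simp add: algebra_simps)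
    have "?N j * ((1 - \<eta>) * ((real s * d)\<^sup>2 * (real n * d)))
        \<le> ?N j * (((real s * d - j)\<^sup>2 - real j * d\<^sup>2) * (real n * d - 4 * s * d - 2 * (d + 2) * d))"
      using r(1) that pos \<eta> by (intro mult_left_mono) (simp_all add: algebra_simps)
    also have "\<dots> \<le> ?N (Suc j) * (Suc j * (n * d)\<^sup>2)"
      by (rule card_graphs_crossing_Suc[OF A B dis q])
    also have "(1 - \<eta>) * ((real s * d)\<^sup>2 * (real n * d)) = x * (real n * d)\<^sup>2"
      using pos by (simp add: x(1) power2_eq_square)
    finally have "(?N j * x) * (real n * d)\<^sup>2 \<le> (?N (Suc j) * Suc j) * (real n * d)\<^sup>2"
      by (simp only: mult.assoc of_nat_mult of_nat_power)
    then show ?thesis using pos by (simp add: mult_le_cancel_right)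
  qed
  have tele: "?N 0 * x ^ J \<le> ?N J * fact J" if "real J \<le> ?\<mu>" for J
    using that
  proof (induction J)
    case (Suc J)
    have "?N 0 * x ^ Suc J = (?N 0 * x ^ J) * x" by simp
    also have "\<dots> \<le> (?N J * fact J) * x" using Suc x by (intro mult_right_mono) auto
    also have "\<dots> = (?N J * x) * fact J" by simp
    also have "\<dots> \<le> (?N (Suc J) * Suc J) * fact J" using Suc by (intro mult_right_mono step) auto
    finally show ?case by (simp add: mult_ac)
  qed simp
  \<comment> \<open>Being at most \<open>x - 1\<close>, this \<open>J\<close> allows
    \<open>(J + 1) ^ (J + 1) \<le> x ^ (J + 1)\<close>, which costs one factor \<open>x\<close>
    after cancelling \<open>x ^ J\<close>. Being at least \<open>x - 2\<close>, it turns
    \<open>exp (- J)\<close> into at most \<open>exp (2 - x)\<close>.\<close>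
  define J where "J = nat \<lfloor>x\<rfloor> - 1"
  have fl: "\<lfloor>x\<rfloor> \<ge> 1" using x(2) by (simp add: le_floor_iff)
  then have "real J = of_int \<lfloor>x\<rfloor> - 1" by (simp add: J_def of_nat_diff nat_le_eq_zle le_nat_iff)
  then have J: "real J + 1 \<le> x" "x - 2 \<le> real J" by linarith+
  have "x \<le> 1 * ?\<mu>" unfolding x(1) using \<eta> by (intro mult_right_mono) auto
  then have J\<mu>: "real J \<le> ?\<mu>" using J by simp
  have "?N 0 * x ^ J * exp J \<le> ?N J * fact J * exp J"
    by (intro mult_right_mono tele J\<mu>) auto
  also have "\<dots> \<le> card (regular_graphs n d) * (fact J * exp J)"
    using finite_regular_graphs by (simp add: card_mono)
  also have "\<dots> \<le> card (regular_graphs n d) * ((real J + 1) ^ (J + 1))"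
    by (intro mult_left_mono fact_exp_le) auto
  also have "\<dots> \<le> card (regular_graphs n d) * (x ^ (J + 1))"
    using J by (intro mult_left_mono power_mono) auto
  finally have "x ^ J * (?N 0 * exp J) \<le> x ^ J * (card (regular_graphs n d) * x)"
    by (simp add: mult_ac)
  then have "?N 0 * exp J \<le> card (regular_graphs n d) * x"
    using x(2) by simp
  then have "?N 0 \<le> card (regular_graphs n d) * x * exp (- real J)"
    by (simp add: exp_minus field_simps)
  also have "\<dots> \<le> card (regular_graphs n d) * x * exp (2 - x)"
    using J(2) x(2) by (intro mult_left_mono) auto
  finally have "?N 0 \<le> x * exp (2 - x) * card (regular_graphs n d)" by (simp add: mult_ac)
  moreover have "{E \<in> regular_graphs n d. crossing A B E = {}}
      \<subseteq> {E \<in> regular_graphs n d. card (crossing A B E) = 0}" by auto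
  then have "card {E \<in> regular_graphs n d. crossing A B E = {}} \<le> card {E \<in> regular_graphs n d. card (crossing A B E) = 0}"
    using finite_regular_graphs by (intro card_mono) auto
  ultimately show ?thesis by linarith
qed

text \<open>Union bound over the pairs of \<open>s\<close>-sets, each set contributing one binomial
  coefficient.\<close>

lemma card_graphs_with_empty_pair:
  fixes n d s :: nat and \<eta> :: real
  assumes pos: "n > 0" "d > 0" "s > 0"
    and \<eta>: "6 * (real s / n) + (3 * real d + 4) / n \<le> \<eta>" "0 \<le> \<eta>" "\<eta> \<le> 1"
    and x: "x = (1 - \<eta>) * (d * real s ^ 2 / n)" "1 \<le> x"
  shows "real (card {E \<in> regular_graphs n d. \<exists>A B. A \<subseteq> {0..<n} \<and> card A = s \<and>
      B \<subseteq> {0..<n} \<and> card B = s \<and> A \<inter> B = {} \<and> crossing A B E = {}})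
    \<le> (exp 1 * n / s) ^ (2 * s) * (x * exp (2 - x)) * card (regular_graphs n d)" (is "real (card ?X) \<le> _")
proof -
  let ?K = "{A. A \<subseteq> {0..<n} \<and> card A = s}"
  let ?I = "{(A, B). (A, B) \<in> ?K \<times> ?K \<and> A \<inter> B = {}}"
  have fK: "finite ?K" by (rule finite_subset[of _ "Pow {0..<n}"]) auto
  have fI: "finite ?I" by (rule finite_subset[of _ "?K \<times> ?K"]) (use fK in auto)
  have "card ?I \<le> card (?K \<times> ?K)" by (rule card_mono) (use fK in auto)
  also have "\<dots> = (n choose s) * (n choose s)"
    using n_subsets[of "{0..<n}" s] by (simp add: card_cartesian_product)
  finally have "real (card ?I) \<le> real (n choose s) * real (n choose s)"
    by (simp only: of_nat_le_iff flip: of_nat_mult)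
  also have "\<dots> \<le> (exp 1 * n / s) ^ s * (exp 1 * n / s) ^ s"
    using pos by (intro mult_mono binomial_le_exp_power) auto
  also have "\<dots> = (exp 1 * n / s) ^ (2 * s)" by (simp add: mult_2 power_add)
  finally have cI: "real (card ?I) \<le> (exp 1 * n / s) ^ (2 * s)" .
  let ?Y = "\<lambda>t. {E \<in> regular_graphs n d. crossing (fst t) (snd t) E = {}}"
  have "?X \<subseteq> (\<Union>t\<in>?I. ?Y t)"
  proof
    fix E assume "E \<in> ?X"
    then obtain A B where "E \<in> regular_graphs n d" "(A, B) \<in> ?I" "crossing A B E = {}" by blast
    then show "E \<in> (\<Union>t\<in>?I. ?Y t)" by (intro UN_I[of "(A, B)"]) auto
  qed
  then have "card ?X \<le> card (\<Union>t\<in>?I. ?Y t)"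
    by (rule card_mono[rotated]) (use fI finite_regular_graphs in auto)
  also have "\<dots> \<le> (\<Sum>t\<in>?I. card (?Y t))" by (rule card_UN_le[OF fI])
  finally have "real (card ?X) \<le> (\<Sum>t\<in>?I. real (card (?Y t)))"
    by (simp only: of_nat_le_iff flip: of_nat_sum)
  also have "\<dots> \<le> (\<Sum>t\<in>?I. x * exp (2 - x) * card (regular_graphs n d))"
  proof (rule sum_mono)
    fix t assume "t \<in> ?I"
    then show "real (card (?Y t)) \<le> x * exp (2 - x) * card (regular_graphs n d)"
      by (intro card_graphs_without_crossing[OF _ _ _ _ _ pos(1,2) \<eta> x]) auto
  qed
  also have "\<dots> = card ?I * (x * exp (2 - x) * card (regular_graphs n d))" by simp
  also have "\<dots> \<le> (exp 1 * n / s) ^ (2 * s) * (x * exp (2 - x) * card (regular_graphs n d))"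
    using x(2) by (intro mult_right_mono cI) auto
  finally show ?thesis by (simp only: mult.assoc)
qed

text \<open>The chronological record of the process: \<open>v i\<close> forces \<open>w i\<close>
  when the black set is \<open>S \<union> w\<close> followed by the image of \<open>{..<i}\<close>.
  At that moment \<open>w i\<close> is the only white neighbour of \<open>v i\<close>, so all its
  neighbours are black afterwards.\<close>

lemma forcing_sequence:
  assumes "(force_step n E)\<^sup>*\<^sup>* S B"
  shows "\<exists>k v w. B = S \<union> w ` {..<k} \<and> inj_on w {..<k} \<and> w ` {..<k} \<inter> S = {} \<and> 
    (\<forall>i<k. v i \<in> S \<union> w ` {..<i} \<and> {v i, w i} \<in> E \<and> (\<forall>u. {v i, u} \<in> E \<longrightarrow> u \<in> S \<union> w ` {..i::nat}))"
  using assms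
proof (induction rule: rtranclp_induct)
  case base
  then show ?case by (intro exI[of _ 0]) auto
next
  case (step B B')
  obtain k v w where IH: "B = S \<union> w ` {..<k}" "inj_on w {..<k}" "w ` {..<k} \<inter> S = {}"
    "\<forall>i<k. v i \<in> S \<union> w ` {..<i} \<and> {v i, w i} \<in> E \<and> (\<forall>u. {v i, u} \<in> E \<longrightarrow> u \<in> S \<union> w ` {..i::nat})"
    using step.IH by blast
  obtain a b where ab: "a \<in> B" "b \<notin> B" "{a, b} \<in> E" "\<And>u. {a, u} \<in> E \<Longrightarrow> u \<notin> B \<Longrightarrow> u = b" "B' = insert b B"
    using step.hyps(2) unfolding force_step_def by blast
  have eq: "(w(k := b)) ` {..<i} = w ` {..<i}" if "i \<le> k" for i
    using that by (intro image_cong) auto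
  have eq2: "(w(k := b)) ` {..i} = w ` {..i}" if "i < k" for i
    using that by (intro image_cong) auto
  have eq3: "(w(k := b)) ` {..k} = insert b (w ` {..<k})"
  proof -
    have "{..k} = insert k {..<k}" by auto
    then show ?thesis using eq[of k] by (simp only: image_insert fun_upd_same)
  qed
  show ?case
  proof (rule exI[of _ "Suc k"], rule exI[of _ "v(k := a)"], rule exI[of _ "w(k := b)"], intro conjI)
    show "B' = S \<union> (w(k := b)) ` {..<Suc k}"
      unfolding lessThan_Suc_atMost eq3 ab(5) IH(1) by blast
    show "inj_on (w(k := b)) {..<Suc k}"
      using IH(2) ab(2) eq[of k] unfolding IH(1) lessThan_Suc
      by (auto simp: inj_on_def)
    show "(w(k := b)) ` {..<Suc k} \<inter> S = {}"
      unfolding lessThan_Suc_atMost eq3 using IH(1,3) ab(2) by blast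
    show "\<forall>i<Suc k. (v(k := a)) i \<in> S \<union> (w(k := b)) ` {..<i} \<and> {(v(k := a)) i, (w(k := b)) i} \<in> E \<and>
         (\<forall>u. {(v(k := a)) i, u} \<in> E \<longrightarrow> u \<in> S \<union> (w(k := b)) ` {..i})"
    proof (intro allI impI)
      fix i assume "i < Suc k"
      then consider "i < k" | "i = k" by linarith
      then show "(v(k := a)) i \<in> S \<union> (w(k := b)) ` {..<i} \<and> {(v(k := a)) i, (w(k := b)) i} \<in> E \<and>
         (\<forall>u. {(v(k := a)) i, u} \<in> E \<longrightarrow> u \<in> S \<union> (w(k := b)) ` {..i})"
      proof cases
        case 1
        then show ?thesis using IH(4)[rule_format, of i] eq[of i] eq2[of i] by simp
      next
        case 2
        show ?thesis
          unfolding 2 fun_upd_same eq[OF order_refl] eq3 using ab(1,3,4) unfolding IH(1) by blast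
      qed
    qed
  qed
qed

text \<open>Every vertex outside \<open>S\<close> is forced once, so there are at least
  \<open>2 * s\<close> steps. The forcers of the first \<open>s\<close> steps and the vertices
  forced in the next \<open>s\<close> steps form the pair.\<close>

lemma zero_forcing_empty_pair:
  assumes regular: "E \<in> regular_graphs n d" and zf: "zero_forcing_set n E S" and s: "card S + 2 * s \<le> n"
  shows "\<exists>A B. A \<subseteq> {0..<n} \<and> card A = s \<and> B \<subseteq> {0..<n} \<and> card B = s \<and> A \<inter> B = {} \<and> crossing A B E = {}"
proof -
  note edge_bounds = edge_bounds[OF regular]
  have "(force_step n E)\<^sup>*\<^sup>* S {0..<n}" using zf by (simp add: zero_forcing_set_def)
  from forcing_sequence[OF this] obtain k v w
    where h: "{0..<n} = S \<union> w ` {..<k}" "inj_on w {..<k}" "w ` {..<k} \<inter> S = {}"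
    and v': "\<forall>i<k. v i \<in> S \<union> w ` {..<i} \<and> {v i, w i} \<in> E \<and> (\<forall>u. {v i, u} \<in> E \<longrightarrow> u \<in> S \<union> w ` {..i::nat})"
    by (elim exE conjE) (rule that)
  have v: "v i \<in> S \<union> w ` {..<i}" "{v i, w i} \<in> E" "{v i, u} \<in> E \<Longrightarrow> u \<in> S \<union> w ` {..i}"
    if "i < k" for i u using v' that by blast+
  have fS: "finite S" using zf unfolding zero_forcing_set_def by (auto intro: finite_subset)
  have "n = card S + card (w ` {..<k})"
    using card_Un_disjoint[of S "w ` {..<k}"] fS h(3) unfolding h(1)[symmetric]
    by (simp add: Int_commute)
  then have k: "2 * s \<le> k" using card_image[OF h(2)] s by simp
  \<comment> \<open>The vertex forced at step \<open>j\<close> is still white right after any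
    earlier step \<open>i\<close>.\<close>
  have late: "w j \<notin> S \<union> w ` {..i}" if "i < j" "j < k" for i j
  proof -
    have "w j \<notin> S" using h(3) that by auto
    moreover have "w j \<noteq> w l" if "l \<le> i" for l
      using inj_onD[OF h(2), of j l] that \<open>i < j\<close> \<open>j < k\<close> by auto
    ultimately show ?thesis by auto
  qed
  have noedge: "{v i, w j} \<notin> E" if "i < j" "j < k" for i j
    using late[OF that] v(3)[of i "w j"] that by auto
  \<comment> \<open>A vertex forces at most once: for \<open>i < j\<close> the vertex
    \<open>v j\<close> is adjacent to \<open>w j\<close>, whereas \<open>v i\<close> is not.\<close>
  have injv: "inj_on v {..<k}"
  proof (rule linorder_inj_onI)
    fix i j assume "i < j" "i \<in> {..<k}" "j \<in> {..<k}"
    then show "v i \<noteq> v j" using noedge[of i j] v(2)[of j] by auto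
  qed auto
  show ?thesis
  proof (intro exI conjI)
    show "v ` {..<s} \<subseteq> {0..<n}" using edge_bounds(1)[OF v(2)] k by auto
    show "w ` {s..<2 * s} \<subseteq> {0..<n}" unfolding h(1) using k by auto
    show "card (v ` {..<s}) = s"
      using k by (subst card_image) (auto intro: inj_on_subset[OF injv])
    show "card (w ` {s..<2 * s}) = s"
      using k by (subst card_image) (auto intro: inj_on_subset[OF h(2)])
    \<comment> \<open>The forcer \<open>v i\<close> is black before step \<open>i\<close>, whereas
      \<open>w j\<close> is white after it.\<close>
    have "v i \<noteq> w j" if "i < s" "s \<le> j" "j < 2 * s" for i j
    proof -
      have "w j \<notin> S \<union> w ` {..i}" using late[of i j] that k by simp
      moreover have "v i \<in> S \<union> w ` {..i}" using v(1)[of i] that k by auto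
      ultimately show ?thesis by metis
    qed
    then show "v ` {..<s} \<inter> w ` {s..<2 * s} = {}" by auto
    show "crossing (v ` {..<s}) (w ` {s..<2 * s}) E = {}"
      using noedge k by (auto simp: crossing_def)
  qed
qed

lemma zero_forcing_number_attained:
  "\<exists>S. zero_forcing_set n E S \<and> card S = zero_forcing_number n E"
proof -
  have "zero_forcing_set n E {0..<n}" by (simp add: zero_forcing_set_def)
  then have "\<exists>k S. zero_forcing_set n E S \<and> card S = k" by blast
  then show ?thesis unfolding zero_forcing_number_def by (rule LeastI_ex)
qed

text \<open>If the bound fails, some zero forcing set leaves more than \<open>2 *\<close> \<tau>
  \<open>* n\<close> vertices to be forced, which yields an empty pair of size \<open>s\<close>
  about \<tau> \<open>* n\<close>. The slightly smaller constant \<tau>\<open>'\<close> leaves room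
  for rounding \<open>s\<close> and still makes the union bound decay exponentially.\<close>

lemma zero_forcing_number_lower_bound:
  fixes \<epsilon> :: real
  assumes "0 < \<epsilon>" "\<epsilon> \<le> 1"
  shows "\<exists>d0. \<forall>d\<ge>d0. \<exists>g :: nat \<Rightarrow> real. g \<longlonglongrightarrow> 0 \<and> (\<forall>\<^sub>F n in sequentially.
    real (card {E \<in> regular_graphs n d.
      \<not> real n * (1 - (1 + \<epsilon>) * (4 * ln (real d) / real d)) \<le> real (zero_forcing_number n E)})
    \<le> g n * card (regular_graphs n d))"
proof -
  have "\<forall>\<^sub>F d :: nat in sequentially. 2 \<le> ln (real d) \<and> 24 * (ln (real d) / d) < \<epsilon> / 16 \<and> 1 < d"
    using assms
    by (intro eventually_conj eventually_ge_ln eventually_ln_over_less eventually_gt_at_top) simp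
  then have "\<forall>\<^sub>F d :: nat in sequentially. 2 \<le> ln (real d) \<and> 24 * (ln (real d) / d) < \<epsilon> / 16 \<and> 1 < real d"
    by simp
  then obtain d0 where d0: "\<And>d. d \<ge> d0 \<Longrightarrow> 2 \<le> ln (real d)" "\<And>d. d \<ge> d0 \<Longrightarrow> 24 * (ln (real d) / d) < \<epsilon> / 16"
    "\<And>d. d \<ge> d0 \<Longrightarrow> 1 < real d"
    unfolding eventually_sequentially by blast
  show ?thesis
  proof (intro exI[of _ d0] allI impI)
    fix d assume d: "d0 \<le> d"
    note dd = d0[OF d]
    define L where "L = ln (real d)"
    \<comment> \<open>With \<eta> \<open>=\<close> \<epsilon> \<open>/ 8\<close> the product
      \<open>(1 -\<close> \<eta>\<open>) * (1 +\<close> \<epsilon> \<open>/ 2)\<close> still exceeds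
      1, so \<open>c\<close> is positive. One half of \<eta> absorbs \<open>6 * s / n\<close>, the
      other half \<open>(3 * d + 4) / n\<close>.\<close>
    define \<eta> \<tau> \<tau>' c where "\<eta> = \<epsilon> / 8" and "\<tau> = 2 * (1 + \<epsilon>) * L / d" and "\<tau>' = 2 * (1 + \<epsilon> / 2) * L / d"
      and "c = 2 * L * ((1 - \<eta>) * (1 + \<epsilon> / 2) - 1)"
    have L: "2 \<le> L" "24 * (L / d) < \<epsilon> / 16" using dd by (auto simp: L_def)
    have dpos: "0 < real d" "0 < d" using dd by auto
    have \<tau>': "0 < \<tau>'" using L dpos assms by (simp add: \<tau>'_def)
    have diff: "\<tau> = \<tau>' + \<epsilon> * (L / d)" using dpos by (simp add: \<tau>_def \<tau>'_def field_simps)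
    have \<tau>_less: "\<tau>' < \<tau>" unfolding diff using L dpos assms by simp
    have "2 * (1 + \<epsilon>) * (L / d) \<le> 4 * (L / d)" using L assms by (intro mult_right_mono) auto
    then have \<tau>_small: "6 * \<tau> \<le> \<epsilon> / 16" using L by (simp add: \<tau>_def)
    have \<eta>: "0 \<le> \<eta>" "\<eta> < 1" using assms by (auto simp: \<eta>_def)
    have "\<epsilon> * \<epsilon> \<le> \<epsilon> * 1" using assms by (intro mult_left_mono) auto
    then have "0 < (1 - \<eta>) * (1 + \<epsilon> / 2) - 1" using assms by (simp add: \<eta>_def field_simps)
    then have c: "0 < c" using L by (simp add: c_def)
    have "exp 1 \<le> (3 :: real)" using exp_le by simp
    also have "\<dots> \<le> 2 * (1 + \<epsilon> / 2) * L" using L assms mult_mono[of 2 "2 + \<epsilon>" 2 L] by simp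
    also have "\<dots> = d * \<tau>'" using dpos by (simp add: \<tau>'_def)
    finally have exp_le_d\<tau>: "exp 1 \<le> d * \<tau>'" .
    define g where "g = (\<lambda>n::nat. real d * n * exp 2 * exp (- (c * \<tau>') * n))"
    have "0 < c * \<tau>'" using c \<tau>' by simp
    then have "g \<longlonglongrightarrow> 0" unfolding g_def using dpos(1) by (rule linear_times_exp_decay)
    moreover have "\<forall>\<^sub>F n in sequentially.
        real (card {E \<in> regular_graphs n d.
          \<not> real n * (1 - (1 + \<epsilon>) * (4 * ln (real d) / real d)) \<le> real (zero_forcing_number n E)})
        \<le> g n * card (regular_graphs n d)"
    proof -
      have "0 < \<tau> - \<tau>'" using \<tau>_less by simp
      then have "\<forall>\<^sub>F n :: nat in sequentially. 1 \<le> (\<tau> - \<tau>') * n"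
        by (rule eventually_linear_ge_1)
      moreover have "\<forall>\<^sub>F n :: nat in sequentially. (3 * real d + 4) / n < \<epsilon> / 16"
        using assms by (intro eventually_const_over_less) simp
      moreover have "0 < (1 - \<eta>) * d * \<tau>' * \<tau>'" using \<eta> \<tau>' dpos by simp
      then have "\<forall>\<^sub>F n :: nat in sequentially. 1 \<le> ((1 - \<eta>) * d * \<tau>' * \<tau>') * n"
        by (rule eventually_linear_ge_1)
      moreover have "\<forall>\<^sub>F n :: nat in sequentially. 0 < n" by (rule eventually_gt_at_top)
      ultimately show ?thesis
      proof eventually_elim
        case (elim n)
        define s where "s = nat \<lfloor>\<tau> * n\<rfloor>"
        have \<tau>n: "0 \<le> \<tau> * n" using \<tau>' \<tau>_less by simp
        \<comment> \<open>Rounding down loses at most 1, which the gap between \<tau> and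
          \<tau>\<open>'\<close> covers for large \<open>n\<close>.\<close>
        have s: "real s \<le> \<tau> * n" "\<tau> * n - 1 \<le> real s" using \<tau>n unfolding s_def by linarith+
        then have s': "\<tau>' * n \<le> real s" using elim(1) by (simp add: algebra_simps)
        have "0 < \<tau>' * n" using \<tau>' elim by simp
        then have spos: "0 < real s" "0 < s" using s' by linarith+
        have sn: "real s / n \<le> \<tau>" using s elim by (simp add: field_simps)
        have "\<tau> \<le> 1" using \<tau>_small assms by simp
        then have "real s / n \<le> 1" using sn by simp
        then have s_le: "real s \<le> n" using elim by simp
        have \<eta>n: "6 * (real s / n) + (3 * real d + 4) / n \<le> \<eta>"
          using elim(2) sn \<tau>_small unfolding \<eta>_def by linarith
        define x where "x = (1 - \<eta>) * (d * real s ^ 2 / n)"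
        have "1 \<le> ((1 - \<eta>) * d * \<tau>' * \<tau>') * n" by (rule elim(3))
        also have "\<dots> = (1 - \<eta>) * (d * (\<tau>' * n) ^ 2 / n)" using elim by (simp add: power2_eq_square)
        also have "\<dots> \<le> x" unfolding x_def using \<eta> s' \<tau>'
          by (intro mult_left_mono divide_right_mono power_mono) auto
        finally have x: "1 \<le> x" .
        let ?X = "{E \<in> regular_graphs n d. \<exists>A B. A \<subseteq> {0..<n} \<and> card A = s \<and>
          B \<subseteq> {0..<n} \<and> card B = s \<and> A \<inter> B = {} \<and> crossing A B E = {}}"
        let ?B = "{E \<in> regular_graphs n d.
          \<not> real n * (1 - (1 + \<epsilon>) * (4 * ln (real d) / real d)) \<le> real (zero_forcing_number n E)}"
        have "?B \<subseteq> ?X"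
        proof
          fix E assume E: "E \<in> ?B"
          then have regular: "E \<in> regular_graphs n d" by simp
          note zero_forcing_empty_pair = zero_forcing_empty_pair[OF regular]
          obtain S where S: "zero_forcing_set n E S" "card S = zero_forcing_number n E"
            using zero_forcing_number_attained by blast
          have "real (card S) < n * (1 - (1 + \<epsilon>) * (4 * L / real d))" using E S by (simp add: L_def)
          also have "\<dots> = n - 2 * (\<tau> * n)" by (simp add: \<tau>_def algebra_simps)
          finally have "real (card S + 2 * s) \<le> real n" using s by simp
          then have "card S + 2 * s \<le> n" by (simp only: of_nat_le_iff)
          from zero_forcing_empty_pair[OF S(1) this] show "E \<in> ?X" using regular by simp
        qed
        then have "real (card ?B) \<le> real (card ?X)"
          using finite_regular_graphs[of n d] by (simp add: card_mono)
        also have "\<dots> \<le> (exp 1 * n / s) ^ (2 * s) * (x * exp (2 - x)) * card (regular_graphs n d)"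
          using elim(4) dpos spos \<eta>n \<eta> x by (intro card_graphs_with_empty_pair[where \<eta> = \<eta>]) (auto simp: x_def)
        also have "\<dots> \<le> g n * card (regular_graphs n d)"
          unfolding g_def
          using elim(4) dpos spos s_le \<eta> s' exp_le_d\<tau> c x
          by (intro mult_right_mono empty_pair_union_bound[where \<eta> = \<eta> and \<epsilon> = \<epsilon>])
            (auto simp: \<tau>'_def c_def x_def L_def)
        finally show ?case .
      qed
    qed
    ultimately show "\<exists>g :: nat \<Rightarrow> real. g \<longlonglongrightarrow> 0 \<and> (\<forall>\<^sub>F n in sequentially.
      real (card {E \<in> regular_graphs n d.
        \<not> real n * (1 - (1 + \<epsilon>) * (4 * ln (real d) / real d)) \<le> real (zero_forcing_number n E)})
      \<le> g n * card (regular_graphs n d))" by blast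
  qed
qed

section \<open>Conclusion\<close>

text \<open>The failure counts add up by a union bound, and dividing by the number of regular graphs
  gives the probability statement.\<close>

lemma aasI:
  fixes g h :: "nat \<Rightarrow> real"
  assumes g: "g \<longlonglongrightarrow> 0" "\<forall>\<^sub>F n in sequentially.
      real (card {E \<in> regular_graphs n d. \<not> P n E}) \<le> g n * card (regular_graphs n d)"
    and h: "h \<longlonglongrightarrow> 0" "\<forall>\<^sub>F n in sequentially.
      real (card {E \<in> regular_graphs n d. \<not> Q n E}) \<le> h n * card (regular_graphs n d)"
    and imp: "\<And>n E. P n E \<Longrightarrow> Q n E \<Longrightarrow> A n E"
  shows "aas d A"
  unfolding aas_def
proof (rule tendsto_sandwich)
  let ?F = "inf sequentially (principal {n. even (n * d)})"
  show "((\<lambda>n. 1 - (g n + h n)) \<longlongrightarrow> 1) ?F"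
  proof (rule tendsto_mono[OF inf_le1])
    have "(\<lambda>n. 1 - (g n + h n)) \<longlonglongrightarrow> 1 - (0 + 0)" by (intro tendsto_intros g h)
    then show "(\<lambda>n. 1 - (g n + h n)) \<longlonglongrightarrow> 1" by simp
  qed
  show "((\<lambda>n. 1) \<longlongrightarrow> (1 :: real)) ?F" by (rule tendsto_const)
  show "\<forall>\<^sub>F n in ?F. prob_reg n d (A n) \<le> 1"
  proof (rule always_eventually, rule allI)
    fix n
    have "card {E \<in> regular_graphs n d. A n E} \<le> card (regular_graphs n d)"
      using finite_regular_graphs by (intro card_mono) auto
    then show "prob_reg n d (A n) \<le> 1" by (auto simp: prob_reg_def divide_le_eq_1)
  qed
  show "\<forall>\<^sub>F n in ?F. 1 - (g n + h n) \<le> prob_reg n d (A n)"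
    unfolding eventually_inf_principal
    using g(2) h(2) eventually_gt_at_top[of d]
  proof eventually_elim
    case (elim n)
    let ?R = "regular_graphs n d"
    show ?case
    proof
      assume "n \<in> {n. even (n * d)}"
      \<comment> \<open>Without any regular graph \<open>prob_reg\<close> would be
        \<open>0 / 0\<close>, which is 0; existence for even \<open>n * d\<close> and
        \<open>n > d\<close> excludes this.\<close>
      then have pos: "0 < card ?R"
        using regular_graphs_nonempty[of d n] elim(3) finite_regular_graphs by (simp add: card_gt_0_iff)
      have "?R \<subseteq> {E \<in> ?R. A n E} \<union> ({E \<in> ?R. \<not> P n E} \<union> {E \<in> ?R. \<not> Q n E})" using imp by blast
      then have "card ?R \<le> card ({E \<in> ?R. A n E} \<union> ({E \<in> ?R. \<not> P n E} \<union> {E \<in> ?R. \<not> Q n E}))"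
        using finite_regular_graphs by (intro card_mono) auto
      also have "\<dots> \<le> card {E \<in> ?R. A n E} + (card {E \<in> ?R. \<not> P n E} + card {E \<in> ?R. \<not> Q n E})"
        by (intro order_trans[OF card_Un_le] add_mono order_refl card_Un_le)
      finally have "real (card ?R) \<le> real (card {E \<in> ?R. A n E})
          + (real (card {E \<in> ?R. \<not> P n E}) + real (card {E \<in> ?R. \<not> Q n E}))"
        by (simp only: of_nat_le_iff flip: of_nat_add)
      also have "\<dots> \<le> real (card {E \<in> ?R. A n E}) + (g n * card ?R + h n * card ?R)"
        using elim by simp
      finally show "1 - (g n + h n) \<le> prob_reg n d (A n)"
        using pos by (simp add: prob_reg_def le_divide_eq algebra_simps)
    qed
  qed
qed

lemma zero_forcing_number_aas_bounds:
  fixes \<epsilon> :: real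
  assumes "\<epsilon> > 0"
  shows "\<exists>d0::nat. \<forall>d::nat. d \<ge> d0 \<longrightarrow>
    aas d (\<lambda>n E.
      real n * (1 - (1 + \<epsilon>) * (4 * ln (real d) / real d)) \<le> real (zero_forcing_number n E) \<and>
      real (zero_forcing_number n E) \<le> real n * (1 - (1 - \<epsilon>) * (ln (real d) / (2 * real d))))"
proof -
  \<comment> \<open>Both estimates are available for parameters up to 1. For larger \<epsilon> the
    bounds only weaken, because \<open>ln d\<close> is nonnegative once \<open>d\<close> is at least
    1.\<close>
  define \<delta> where "\<delta> = min \<epsilon> 1"
  have \<delta>: "0 < \<delta>" "\<delta> \<le> 1" "\<delta> \<le> \<epsilon>" using \<open>\<epsilon> > 0\<close> by (auto simp: \<delta>_def)
  let ?P = "\<lambda>d n E. real n * (1 - (1 + \<delta>) * (4 * ln (real d) / real d)) \<le> real (zero_forcing_number n E)"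
  let ?Q = "\<lambda>d n E. real (zero_forcing_number n E) \<le> real n * (1 - (1 - \<delta>) * (ln (real d) / (2 * real d)))"
  obtain d1 where d1: "\<forall>d\<ge>d1. \<exists>g :: nat \<Rightarrow> real. g \<longlonglongrightarrow> 0 \<and> (\<forall>\<^sub>F n in sequentially.
      real (card {E \<in> regular_graphs n d. \<not> ?P d n E}) \<le> g n * card (regular_graphs n d))"
    using zero_forcing_number_lower_bound[OF \<delta>(1,2)] by blast
  obtain d2 where d2: "\<forall>d\<ge>d2. \<exists>g :: nat \<Rightarrow> real. g \<longlonglongrightarrow> 0 \<and> (\<forall>\<^sub>F n in sequentially.
      real (card {E \<in> regular_graphs n d. \<not> ?Q d n E}) \<le> g n * card (regular_graphs n d))"
    using zero_forcing_number_upper_bound[OF \<delta>(1,2)] by blast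
  show "\<exists>d0. \<forall>d\<ge>d0. aas d (\<lambda>n E.
      real n * (1 - (1 + \<epsilon>) * (4 * ln (real d) / real d)) \<le> real (zero_forcing_number n E) \<and>
      real (zero_forcing_number n E) \<le> real n * (1 - (1 - \<epsilon>) * (ln (real d) / (2 * real d))))"
  proof (intro exI[of _ "max 1 (max d1 d2)"] allI impI)
    fix d assume d: "max 1 (max d1 d2) \<le> d"
    obtain g :: "nat \<Rightarrow> real" where g: "g \<longlonglongrightarrow> 0" "\<forall>\<^sub>F n in sequentially.
        real (card {E \<in> regular_graphs n d. \<not> ?P d n E}) \<le> g n * card (regular_graphs n d)"
      using d1 d by (meson max.boundedE)
    obtain h :: "nat \<Rightarrow> real" where h: "h \<longlonglongrightarrow> 0" "\<forall>\<^sub>F n in sequentially.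
        real (card {E \<in> regular_graphs n d. \<not> ?Q d n E}) \<le> h n * card (regular_graphs n d)"
      using d2 d by (meson max.boundedE)
    have "0 \<le> ln (real d)" using d by simp
    then have nonneg: "0 \<le> 4 * ln (real d) / real d" "0 \<le> ln (real d) / (2 * real d)" by auto
    show "aas d (\<lambda>n E.
      real n * (1 - (1 + \<epsilon>) * (4 * ln (real d) / real d)) \<le> real (zero_forcing_number n E) \<and>
      real (zero_forcing_number n E) \<le> real n * (1 - (1 - \<epsilon>) * (ln (real d) / (2 * real d))))"
    proof (rule aasI[OF g h], rule conjI)
      fix n E assume PQ: "?P d n E" "?Q d n E"
      have "real n * (1 - (1 + \<epsilon>) * (4 * ln (real d) / real d))
          \<le> real n * (1 - (1 + \<delta>) * (4 * ln (real d) / real d))"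
        using \<delta>(3) nonneg(1) by (intro mult_left_mono diff_left_mono mult_right_mono) auto
      then show "real n * (1 - (1 + \<epsilon>) * (4 * ln (real d) / real d)) \<le> real (zero_forcing_number n E)"
        using PQ(1) by linarith
      have "real n * (1 - (1 - \<delta>) * (ln (real d) / (2 * real d)))
          \<le> real n * (1 - (1 - \<epsilon>) * (ln (real d) / (2 * real d)))"
        using \<delta>(3) nonneg(2) by (intro mult_left_mono diff_left_mono mult_right_mono) auto
      then show "real (zero_forcing_number n E) \<le> real n * (1 - (1 - \<epsilon>) * (ln (real d) / (2 * real d)))"
        using PQ(2) by linarith
    qed
  qed
qed

theorem mainTheorem1:
  shows "\<forall>\<epsilon>::real. \<epsilon> > 0 \<longrightarrow> (\<exists>d0::nat. \<forall>d::nat. d \<ge> d0 \<longrightarrow>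
    aas d (\<lambda>n E.
      real n * (1 - (1 + \<epsilon>) * (4 * ln (real d) / real d)) \<le> real (zero_forcing_number n E) \<and>
      real (zero_forcing_number n E) \<le> real n * (1 - (1 - \<epsilon>) * (ln (real d) / (2 * real d)))))"
  using zero_forcing_number_aas_bounds by blast

end
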